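(* Let $(M^4,g)$ be a compact connected Riemannian manifold of dimension $4$. The identity map of $M$ is C-harmonic from $(M,[g])$ to $(M,g)$ if and only if the scalar curvature of $g$ is constant.
   Context: $T\varphi$ is a section of $T^*M\otimes\varphi^*TN$, $d$ is the covariant derivative on sections of $\varphi^*TN$ and $\delta=-\mathrm{div}$ its formal adjoint (with respect to $g$ and $h$). When $\dim M=4$, a smooth map $\varphi:(M,g)\to(N,h)$ is C-harmonic (conformal-harmonic) from $(M,[g])$ to $(N,h)$ if $$\delta d\,\delta T\varphi+\delta\big((\tfrac23\mathrm{Scal}^g-2\,\mathrm{Ric}^g)T\varphi\big)-\mathrm{S}(\delta T\varphi)=0,$$ where $\mathrm{Ric}^g\,T\varphi=T\varphi\circ\mathrm{Ric}^g$, $\mathrm{S}(X)=\sum_{i=1}^4R^h_{X,T\varphi(e_i)}T\varphi(e_i)$ for a $g$-orthonormal basis $(e_i)$, and $R^h_{X,Y}=[\nabla_X,\nabla_Y]-\nabla_{[X,Y]}$. This depends on $g$ only through its conformal class. *)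

theory Defs
  imports "HOL-Analysis.Analysis"
begin

section \<open>Smooth manifolds given by an atlas\<close>

text \<open>\<open>differentiable_upto n f S\<close> is meant for open \<open>S\<close>: \<open>f\<close> is of class \<open>C\<^sup>n\<close> on \<open>S\<close>.\<close>

primrec differentiable_upto ::
  "nat \<Rightarrow> ('a::real_normed_vector \<Rightarrow> 'b::real_normed_vector) \<Rightarrow> 'a set \<Rightarrow> bool" where
  "differentiable_upto 0 f S \<longleftrightarrow> continuous_on S f"
| "differentiable_upto (Suc n) f S \<longleftrightarrow>
     (\<forall>x\<in>S. f differentiable (at x)) \<and>
     (\<forall>v. differentiable_upto n (\<lambda>x. frechet_derivative f (at x) v) S)"

definition smooth_on :: "('a::real_normed_vector \<Rightarrow> 'b::real_normed_vector) \<Rightarrow> 'a set \<Rightarrow> bool" where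
  "smooth_on f S \<longleftrightarrow> (\<forall>n. differentiable_upto n f S)"

datatype ('m, 'n::finite) chart = Chart (chart_dom: "'m set") (coord: "'m \<Rightarrow> real^'n")

definition coord_inv :: "('m, 'n::finite) chart \<Rightarrow> real^'n \<Rightarrow> 'm" where
  "coord_inv c = inv_into (chart_dom c) (coord c)"

definition is_chart :: "('m::topological_space, 'n::finite) chart \<Rightarrow> bool" where
  "is_chart c \<longleftrightarrow> open (chart_dom c) \<and> open (coord c ` chart_dom c) \<and>
     homeomorphism (chart_dom c) (coord c ` chart_dom c) (coord c) (coord_inv c)"

text \<open>The underlying set of the manifold is the whole type \<open>'m\<close>, and its dimension is
  \<open>CARD('n)\<close>. The Hausdorff and countability axioms are sort constraints on \<open>'m\<close>.\<close>

definition smooth_atlas ::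
  "('m::{t2_space, second_countable_topology}, 'n::finite) chart set \<Rightarrow> bool" where
  "smooth_atlas A \<longleftrightarrow>
     (\<forall>c\<in>A. is_chart c) \<and> (\<Union>c\<in>A. chart_dom c) = UNIV \<and>
     (\<forall>c\<in>A. \<forall>d\<in>A. smooth_on (coord d \<circ> coord_inv c) (coord c ` (chart_dom c \<inter> chart_dom d)))"

definition local_rep ::
  "('m, 'k::finite) chart \<Rightarrow> ('n, 'l::finite) chart \<Rightarrow> ('m \<Rightarrow> 'n) \<Rightarrow> real^'k \<Rightarrow> real^'l" where
  "local_rep c d \<phi> = coord d \<circ> \<phi> \<circ> coord_inv c"

definition smooth_map ::
  "('m::topological_space, 'k::finite) chart set \<Rightarrow> ('n::topological_space, 'l::finite) chart set
     \<Rightarrow> ('m \<Rightarrow> 'n) \<Rightarrow> bool" where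
  "smooth_map A B \<phi> \<longleftrightarrow> continuous_on UNIV \<phi> \<and>
     (\<forall>c\<in>A. \<forall>d\<in>B. smooth_on (local_rep c d \<phi>) (coord c ` (chart_dom c \<inter> \<phi> -` chart_dom d)))"


section \<open>Riemannian metrics\<close>

definition jacobian :: "(real^'k::finite \<Rightarrow> real^'l::finite) \<Rightarrow> real^'k \<Rightarrow> real^'k^'l" where
  "jacobian F x = matrix (frechet_derivative F (at x))"

text \<open>A metric is given by its Gram matrices \<open>g c x\<close> with respect to the coordinate frame of each
  chart \<open>c\<close> of the atlas, at the point with coordinates \<open>x\<close>; the last condition says that these
  transform as a covariant 2-tensor, i.e. that they represent one tensor field on the manifold.\<close>

type_synonym ('m, 'n) metric = "('m, 'n) chart \<Rightarrow> real^'n \<Rightarrow> real^'n^'n"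

definition riemannian_metric ::
  "('m::topological_space, 'n::finite) chart set \<Rightarrow> ('m, 'n) metric \<Rightarrow> bool" where
  "riemannian_metric A g \<longleftrightarrow>
     (\<forall>c\<in>A. smooth_on (g c) (coord c ` chart_dom c)) \<and>
     (\<forall>c\<in>A. \<forall>x\<in>coord c ` chart_dom c.
        transpose (g c x) = g c x \<and> (\<forall>v. v \<noteq> 0 \<longrightarrow> v \<bullet> (g c x *v v) > 0)) \<and>
     (\<forall>c\<in>A. \<forall>d\<in>A. \<forall>x\<in>coord c ` (chart_dom c \<inter> chart_dom d).
        let T = coord d \<circ> coord_inv c
        in g c x = transpose (jacobian T x) ** g d (T x) ** jacobian T x)"

definition riemannian_manifold ::
  "('m::{t2_space, second_countable_topology}, 'n::finite) chart set \<Rightarrow> ('m, 'n) metric \<Rightarrow> bool" where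
  "riemannian_manifold A g \<longleftrightarrow> smooth_atlas A \<and> riemannian_metric A g"


section \<open>Levi-Civita connection and curvature in coordinates\<close>

text \<open>In this section \<open>G\<close> is the Gram matrix function of a metric in a fixed chart.\<close>

definition pderiv_at :: "'n::finite \<Rightarrow> (real^'n \<Rightarrow> real) \<Rightarrow> real^'n \<Rightarrow> real" where
  "pderiv_at i f x = frechet_derivative f (at x) (axis i 1)"

text \<open>\<open>christoffel G x k i j\<close> is the symbol with upper index \<open>k\<close>:
  \<open>\<nabla>\<^sub>i \<partial>\<^sub>j = (\<Sum>k. christoffel G x k i j \<partial>\<^sub>k)\<close>.\<close>

definition christoffel ::
  "(real^'n::finite \<Rightarrow> real^'n^'n) \<Rightarrow> real^'n \<Rightarrow> 'n \<Rightarrow> 'n \<Rightarrow> 'n \<Rightarrow> real" where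
  "christoffel G x k i j =
     (\<Sum>l\<in>UNIV. matrix_inv (G x) $ k $ l *
        (pderiv_at i (\<lambda>y. G y $ j $ l) x + pderiv_at j (\<lambda>y. G y $ i $ l) x
         - pderiv_at l (\<lambda>y. G y $ i $ j) x)) / 2"

text \<open>Components of \<open>R(X,Y) = [\<nabla>\<^sub>X, \<nabla>\<^sub>Y] - \<nabla>\<^bsub>[X,Y]\<^esub>\<close>:
  \<open>R(\<partial>\<^sub>i, \<partial>\<^sub>j) \<partial>\<^sub>k = (\<Sum>l. riemann G x l k i j \<partial>\<^sub>l)\<close>.\<close>

definition riemann ::
  "(real^'n::finite \<Rightarrow> real^'n^'n) \<Rightarrow> real^'n \<Rightarrow> 'n \<Rightarrow> 'n \<Rightarrow> 'n \<Rightarrow> 'n \<Rightarrow> real" where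
  "riemann G x l k i j =
     pderiv_at i (\<lambda>y. christoffel G y l j k) x - pderiv_at j (\<lambda>y. christoffel G y l i k) x
     + (\<Sum>m\<in>UNIV. christoffel G x l i m * christoffel G x m j k
                - christoffel G x l j m * christoffel G x m i k)"

definition curvature_op ::
  "(real^'n::finite \<Rightarrow> real^'n^'n) \<Rightarrow> real^'n \<Rightarrow> real^'n \<Rightarrow> real^'n \<Rightarrow> real^'n \<Rightarrow> real^'n" where
  "curvature_op G x X Y Z =
     (\<chi> l. \<Sum>i\<in>UNIV. \<Sum>j\<in>UNIV. \<Sum>k\<in>UNIV. riemann G x l k i j * X $ i * Y $ j * Z $ k)"

text \<open>\<open>Ric(Y,Z)\<close> is the trace of \<open>X \<mapsto> R(X,Y)Z\<close>.\<close>

definition ricci_form :: "(real^'n::finite \<Rightarrow> real^'n^'n) \<Rightarrow> real^'n \<Rightarrow> real^'n^'n" where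
  "ricci_form G x = (\<chi> j k. \<Sum>i\<in>UNIV. riemann G x i k i j)"

definition ricci_endo :: "(real^'n::finite \<Rightarrow> real^'n^'n) \<Rightarrow> real^'n \<Rightarrow> real^'n^'n" where
  "ricci_endo G x = matrix_inv (G x) ** ricci_form G x"

definition scal :: "(real^'n::finite \<Rightarrow> real^'n^'n) \<Rightarrow> real^'n \<Rightarrow> real" where
  "scal G x = trace (ricci_endo G x)"

text \<open>The value does not depend on the chart around \<open>p\<close>.\<close>

definition scalar_curvature ::
  "('m, 'n::finite) chart set \<Rightarrow> ('m, 'n) metric \<Rightarrow> 'm \<Rightarrow> real" where
  "scalar_curvature A g p =
     (let c = (SOME c. c \<in> A \<and> p \<in> chart_dom c) in scal (g c) (coord c p))"


section \<open>C-harmonic maps\<close>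

text \<open>\<open>F\<close> is the expression of a map in a chart of the source, where the metric is \<open>G\<close>, and a chart of
  the target, where the metric is \<open>H\<close>. Latin indices refer to the source, Greek ones to the target.
  A section of the pull-back \<open>\<phi>\<^sup>*TN\<close> is represented by its component vector \<open>\<xi> x $ \<alpha>\<close>, and a section
  of \<open>T\<^sup>*M \<otimes> \<phi>\<^sup>*TN\<close> by the matrix function \<open>\<omega> x $ \<alpha> $ i\<close> (so \<open>T\<phi>\<close> is the Jacobian matrix, and
  composition with an endomorphism of \<open>TM\<close> is the matrix product). Pull-back bundles carry the pull-back
  of the Levi-Civita connection of \<open>H\<close>.\<close>

definition cov_d ::
  "(real^'l::finite \<Rightarrow> real^'l^'l) \<Rightarrow> (real^'k::finite \<Rightarrow> real^'l) \<Rightarrow> (real^'k \<Rightarrow> real^'l)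
     \<Rightarrow> real^'k \<Rightarrow> real^'k^'l" where
  "cov_d H F \<xi> x = (\<chi> \<alpha> i. pderiv_at i (\<lambda>y. \<xi> y $ \<alpha>) x
     + (\<Sum>\<beta>\<in>UNIV. \<Sum>\<gamma>\<in>UNIV. christoffel H (F x) \<alpha> \<beta> \<gamma> * pderiv_at i (\<lambda>y. F y $ \<beta>) x * \<xi> x $ \<gamma>))"

text \<open>\<open>nabla_form G H F \<omega> x j \<alpha> i\<close> is the \<open>\<alpha>\<close>-component of \<open>(\<nabla>\<^sub>j \<omega>)(\<partial>\<^sub>i)\<close>.\<close>

definition nabla_form ::
  "(real^'k::finite \<Rightarrow> real^'k^'k) \<Rightarrow> (real^'l::finite \<Rightarrow> real^'l^'l) \<Rightarrow> (real^'k \<Rightarrow> real^'l)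
     \<Rightarrow> (real^'k \<Rightarrow> real^'k^'l) \<Rightarrow> real^'k \<Rightarrow> 'k \<Rightarrow> 'l \<Rightarrow> 'k \<Rightarrow> real" where
  "nabla_form G H F \<omega> x j \<alpha> i = pderiv_at j (\<lambda>y. \<omega> y $ \<alpha> $ i) x
     - (\<Sum>k\<in>UNIV. christoffel G x k j i * \<omega> x $ \<alpha> $ k)
     + (\<Sum>\<beta>\<in>UNIV. \<Sum>\<gamma>\<in>UNIV. christoffel H (F x) \<alpha> \<beta> \<gamma> * pderiv_at j (\<lambda>y. F y $ \<beta>) x * \<omega> x $ \<gamma> $ i)"

text \<open>\<open>codiff\<close> is \<open>\<delta> = - div\<close>, minus the \<open>g\<close>-trace of the covariant derivative.\<close>

definition codiff ::
  "(real^'k::finite \<Rightarrow> real^'k^'k) \<Rightarrow> (real^'l::finite \<Rightarrow> real^'l^'l) \<Rightarrow> (real^'k \<Rightarrow> real^'l)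
     \<Rightarrow> (real^'k \<Rightarrow> real^'k^'l) \<Rightarrow> real^'k \<Rightarrow> real^'l" where
  "codiff G H F \<omega> x =
     (\<chi> \<alpha>. - (\<Sum>i\<in>UNIV. \<Sum>j\<in>UNIV. matrix_inv (G x) $ i $ j * nabla_form G H F \<omega> x i \<alpha> j))"

definition orthonormal_frame ::
  "(real^'k::finite \<Rightarrow> real^'k^'k) \<Rightarrow> real^'k \<Rightarrow> ('k \<Rightarrow> real^'k) \<Rightarrow> bool" where
  "orthonormal_frame G x e \<longleftrightarrow> (\<forall>i j. e i \<bullet> (G x *v e j) = (if i = j then 1 else 0))"

text \<open>\<open>S(X) = \<Sum>\<^sub>i R\<^sup>h(X, T\<phi>(e\<^sub>i)) T\<phi>(e\<^sub>i)\<close>; the choice of the \<open>g\<close>-orthonormal basis is immaterial.\<close>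

definition S_op ::
  "(real^'k::finite \<Rightarrow> real^'k^'k) \<Rightarrow> (real^'l::finite \<Rightarrow> real^'l^'l) \<Rightarrow> (real^'k \<Rightarrow> real^'l)
     \<Rightarrow> (real^'k \<Rightarrow> real^'l) \<Rightarrow> real^'k \<Rightarrow> real^'l" where
  "S_op G H F \<xi> x =
     (let e = (SOME e. orthonormal_frame G x e); T = jacobian F x
      in \<Sum>i\<in>UNIV. curvature_op H (F x) (\<xi> x) (T *v e i) (T *v e i))"

definition C_operator ::
  "(real^4 \<Rightarrow> real^4^4) \<Rightarrow> (real^'l::finite \<Rightarrow> real^'l^'l) \<Rightarrow> (real^4 \<Rightarrow> real^'l)
     \<Rightarrow> real^4 \<Rightarrow> real^'l" where
  "C_operator G H F x =
     (let \<delta> = codiff G H F; d = cov_d H F; T = jacobian F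
      in \<delta> (d (\<delta> T)) x
         + \<delta> (\<lambda>y. (2/3 * scal G y) *\<^sub>R T y - 2 *\<^sub>R (T y ** ricci_endo G y)) x
         - S_op G H F (\<delta> T) x)"

text \<open>The equation is written with a representative \<open>g\<close> of the conformal class of the source; its
  validity is conformally invariant. It is tensorial, so it may be tested in the charts of the atlases.\<close>

definition C_harmonic ::
  "('m::topological_space, 4) chart set \<Rightarrow> ('m, 4) metric
     \<Rightarrow> ('n::topological_space, 'l::finite) chart set \<Rightarrow> ('n, 'l) metric \<Rightarrow> ('m \<Rightarrow> 'n) \<Rightarrow> bool" where
  "C_harmonic A g B h \<phi> \<longleftrightarrow> smooth_map A B \<phi> \<and>
     (\<forall>c\<in>A. \<forall>d\<in>B. \<forall>p\<in>chart_dom c \<inter> \<phi> -` chart_dom d.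
        C_operator (g c) (h d) (local_rep c d \<phi>) (coord c p) = 0)"

end

(* A local isometry F satisfies \<nabla>(TF) = 0 (uniqueness of the Levi-Civita connection), so
   \<delta>(TF) = 0 and the first and third terms of the C-harmonic operator vanish.  The middle term is TF applied to
   \<delta>((2/3) Scal Id - 2 Ric) = -(2/3) grad Scal + 2 div Ric, which by the contracted Bianchi identity
   equals (1/3) grad Scal.  This is used for the coordinate changes of the atlas, which are the local
   expressions of the identity map.  In a chart, connection and curvature are matrix-valued functions
   A_i and R_ij = d_i A_j - d_j A_i + [A_i, A_j], so that the Bianchi identity, the skew-symmetry of the
   curvature and its transformation under isometries are non-commutative polynomial identities. *)

theory Submission
  imports Defs
begin

section \<open>Smooth functions\<close>

text \<open>The equation is tested in every pair of charts, so the identity is seen as a transition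
  map F between two different Gram matrix functions, and the operator has to be evaluated with the
  Jacobian J of F in place. The relation \<open>J A_i = d_i J + B_i J\<close>
  (\<open>J_conn\<close>, with B the pulled-back connection of the target) makes this possible: it
  pulls J out of every covariant derivative, and J is invertible. The equivalence then rests on the
  coefficient 2 * 1/2 - 2/3 = 1/3 of the middle term not being zero. Skew-symmetry of the curvature
  is stated for \<open>R_ij P\<close>, with P the inverse Gram matrix: it comes from the commuting
  second derivatives of P, and P is what the traces in the contracted Bianchi identity contain. A
  vanishing gradient gives constancy only locally, since a chart image may be disconnected;
  connectedness of the manifold does the rest.\<close>

lemma differentiable_upto_Suc_imp:
  "differentiable_upto (Suc n) f S \<Longrightarrow> differentiable_upto n f S"
proof (induction n arbitrary: f)
  case 0
  then show ?case
    by (auto intro!: continuous_at_imp_continuous_on differentiable_imp_continuous_within)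
qed auto

lemma differentiable_upto_subset: "differentiable_upto n f S \<Longrightarrow> T \<subseteq> S \<Longrightarrow> differentiable_upto n f T"
  by (induction n arbitrary: f) (auto intro: continuous_on_subset)

text \<open>On an open set, equality of functions passes to their derivatives. The closure proofs
  below rely on this to replace \<open>frechet_derivative\<close> by an explicit formula that is
  known only on S.\<close>

lemma differentiable_upto_cong:
  assumes "open S" "\<And>x. x \<in> S \<Longrightarrow> f x = g x" "differentiable_upto n f S"
  shows "differentiable_upto n g S"
  using assms(2,3)
proof (induction n arbitrary: f g)
  case 0
  then show ?case
    by (simp cong: continuous_on_cong)
next
  case (Suc n)
  have "g differentiable (at x)" if "x \<in> S" for x
    using Suc.prems that assms(1)
    by (metis has_derivative_transform_within_open differentiable_def differentiable_upto.simps(2))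
  moreover have "frechet_derivative f (at x) = frechet_derivative g (at x)" if "x \<in> S" for x
    using Suc.prems that assms(1) by (intro frechet_derivative_transform_within_open) auto
  moreover have "differentiable_upto n (\<lambda>x. frechet_derivative g (at x) v) S" for v
    by (rule Suc.IH[of "\<lambda>x. frechet_derivative f (at x) v"]) (use Suc.prems calculation in auto)
  ultimately show ?case by simp
qed

lemma smooth_on_cong:
  assumes "open S" "smooth_on f S" "\<And>x. x \<in> S \<Longrightarrow> g x = f x"
  shows "smooth_on g S"
  using assms differentiable_upto_cong[of S f g] by (auto simp: smooth_on_def)

lemma smooth_on_imp_differentiable:
  "smooth_on f S \<Longrightarrow> x \<in> S \<Longrightarrow> f differentiable (at x)"
  unfolding smooth_on_def by (metis differentiable_upto.simps(2))

lemma smooth_on_imp_continuous_on: "smooth_on f S \<Longrightarrow> continuous_on S f"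
  unfolding smooth_on_def by (metis differentiable_upto.simps(1))

lemma smooth_on_frechet_derivative:
  "smooth_on f S \<Longrightarrow> smooth_on (\<lambda>x. frechet_derivative f (at x) v) S"
  unfolding smooth_on_def by (metis differentiable_upto.simps(2))

lemma smooth_on_pderiv_at: "smooth_on f S \<Longrightarrow> smooth_on (pderiv_at i f) S"
  unfolding pderiv_at_def by (rule smooth_on_frechet_derivative)

lemma smooth_on_const: "smooth_on (\<lambda>x. c) S"
proof -
  have "differentiable_upto n (\<lambda>x. c) S" for n
    by (induction n arbitrary: c) auto
  then show ?thesis by (simp add: smooth_on_def)
qed

lemma smooth_on_bounded_linear:
  assumes "open S" "bounded_linear L" "smooth_on f S"
  shows "smooth_on (\<lambda>x. L (f x)) S"
proof -
  interpret L: bounded_linear L by fact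
  have "differentiable_upto n (\<lambda>x. L (f x)) S" if "differentiable_upto n f S" for n
    using that
  proof (induction n arbitrary: f)
    case 0
    then show ?case by (auto intro: L.continuous_on)
  next
    case (Suc n)
    have der: "((\<lambda>x. L (f x)) has_derivative (\<lambda>v. L (frechet_derivative f (at x) v))) (at x)"
      if "x \<in> S" for x
      using Suc.prems that by (auto intro!: L.has_derivative simp: frechet_derivative_works[symmetric])
    have "differentiable_upto n (\<lambda>x. L (frechet_derivative f (at x) v)) S" for v
      using Suc by auto
    then have "differentiable_upto n (\<lambda>x. frechet_derivative (\<lambda>x. L (f x)) (at x) v) S" for v
      by (rule differentiable_upto_cong[OF assms(1), rotated])
        (simp add: frechet_derivative_at[OF der, symmetric])
    then show ?case using der by (auto simp: differentiable_def)
  qed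
  then show ?thesis using assms(3) by (auto simp: smooth_on_def)
qed

lemma differentiable_upto_add:
  assumes "open S" "differentiable_upto n f S" "differentiable_upto n g S"
  shows "differentiable_upto n (\<lambda>x. f x + g x) S"
  using assms(2,3)
proof (induction n arbitrary: f g)
  case 0
  then show ?case by (auto intro: continuous_intros)
next
  case (Suc n)
  have der: "((\<lambda>x. f x + g x) has_derivative
      (\<lambda>v. frechet_derivative f (at x) v + frechet_derivative g (at x) v)) (at x)"
    if "x \<in> S" for x
    using Suc.prems that by (auto intro!: has_derivative_add simp: frechet_derivative_works[symmetric])
  have "differentiable_upto n
      (\<lambda>x. frechet_derivative f (at x) v + frechet_derivative g (at x) v) S" for v
    using Suc by auto
  then have "differentiable_upto n (\<lambda>x. frechet_derivative (\<lambda>x. f x + g x) (at x) v) S" for v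
    by (rule differentiable_upto_cong[OF assms(1), rotated])
      (simp add: frechet_derivative_at[OF der, symmetric])
  then show ?case using der by (auto simp: differentiable_def)
qed

lemma smooth_on_add:
  "open S \<Longrightarrow> smooth_on f S \<Longrightarrow> smooth_on g S \<Longrightarrow> smooth_on (\<lambda>x. f x + g x) S"
  by (auto simp: smooth_on_def intro: differentiable_upto_add)

lemma differentiable_upto_mult:
  fixes f g :: "'a::real_normed_vector \<Rightarrow> real"
  assumes "open S" "differentiable_upto n f S" "differentiable_upto n g S"
  shows "differentiable_upto n (\<lambda>x. f x * g x) S"
  using assms(2,3)
proof (induction n arbitrary: f g)
  case 0
  then show ?case by (auto intro: continuous_intros)
next
  case (Suc n)
  have der: "((\<lambda>x. f x * g x) has_derivative
      (\<lambda>v. f x * frechet_derivative g (at x) v + frechet_derivative f (at x) v * g x)) (at x)"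
    if "x \<in> S" for x
    using Suc.prems that by (auto intro!: has_derivative_mult simp: frechet_derivative_works[symmetric])
  \<comment> \<open>The product rule also contains f and g undifferentiated, so their order has to
    be lowered to n before the induction hypothesis applies.\<close>
  have "differentiable_upto n f S" "differentiable_upto n g S"
    using Suc.prems differentiable_upto_Suc_imp by blast+
  then have "differentiable_upto n
      (\<lambda>x. f x * frechet_derivative g (at x) v + frechet_derivative f (at x) v * g x) S" for v
    using Suc.prems by (intro differentiable_upto_add assms(1) Suc.IH) auto
  then have "differentiable_upto n (\<lambda>x. frechet_derivative (\<lambda>x. f x * g x) (at x) v) S" for v
    by (rule differentiable_upto_cong[OF assms(1), rotated])
      (simp add: frechet_derivative_at[OF der, symmetric])
  then show ?case using der by (auto simp: differentiable_def)
qed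

lemma smooth_on_mult:
  fixes f g :: "'a::real_normed_vector \<Rightarrow> real"
  shows "open S \<Longrightarrow> smooth_on f S \<Longrightarrow> smooth_on g S \<Longrightarrow> smooth_on (\<lambda>x. f x * g x) S"
  by (auto simp: smooth_on_def intro: differentiable_upto_mult)

lemma smooth_on_minus:
  fixes f :: "'a::real_normed_vector \<Rightarrow> real"
  shows "open S \<Longrightarrow> smooth_on f S \<Longrightarrow> smooth_on (\<lambda>x. - f x) S"
  using smooth_on_mult[OF _ smooth_on_const[of "-1"], of S f] by simp

lemma smooth_on_diff:
  fixes f g :: "'a::real_normed_vector \<Rightarrow> real"
  shows "open S \<Longrightarrow> smooth_on f S \<Longrightarrow> smooth_on g S \<Longrightarrow> smooth_on (\<lambda>x. f x - g x) S"
  using smooth_on_add[OF _ _ smooth_on_minus, of S f g] by simp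

lemma smooth_on_sum:
  assumes "open S" "\<And>i. i \<in> I \<Longrightarrow> smooth_on (f i) S"
  shows "smooth_on (\<lambda>x. \<Sum>i\<in>I. f i x) S"
  using assms(2)
  by (induction I rule: infinite_finite_induct) (simp_all add: smooth_on_const smooth_on_add assms(1))

lemma smooth_on_prod:
  fixes f :: "'i \<Rightarrow> 'a::real_normed_vector \<Rightarrow> real"
  assumes "open S" "\<And>i. i \<in> I \<Longrightarrow> smooth_on (f i) S"
  shows "smooth_on (\<lambda>x. \<Prod>i\<in>I. f i x) S"
  using assms(2)
  by (induction I rule: infinite_finite_induct) (simp_all add: smooth_on_const smooth_on_mult assms(1))

text \<open>The derivative -(1/f) f' (1/f) involves only 1/f itself and a derivative of f, which is
  smooth to all orders; the induction on the order therefore keeps f fixed.\<close>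

lemma smooth_on_inverse:
  fixes f :: "'a::real_normed_vector \<Rightarrow> real"
  assumes "open S" "smooth_on f S" "\<And>x. x \<in> S \<Longrightarrow> f x \<noteq> 0"
  shows "smooth_on (\<lambda>x. inverse (f x)) S"
proof -
  have "differentiable_upto n (\<lambda>x. inverse (f x)) S" for n
  proof (induction n)
    case 0
    then show ?case
      using smooth_on_imp_continuous_on[OF assms(2)] assms(3) by (auto intro: continuous_on_inverse)
  next
    case (Suc n)
    have der: "((\<lambda>x. inverse (f x)) has_derivative
        (\<lambda>v. - (inverse (f x) * frechet_derivative f (at x) v * inverse (f x)))) (at x)"
      if "x \<in> S" for x
      using assms that
      by (intro Deriv.has_derivative_inverse)
        (auto simp: frechet_derivative_works[symmetric] smooth_on_imp_differentiable)
    have D: "differentiable_upto n (\<lambda>x. frechet_derivative f (at x) v) S"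
      and c: "differentiable_upto n (\<lambda>x. - 1 :: real) S" for v
      using assms(2) smooth_on_const[of "- 1 :: real" S] smooth_on_frechet_derivative[of f S v]
      unfolding smooth_on_def by blast+
    have "differentiable_upto n
        (\<lambda>x. - 1 * (inverse (f x) * frechet_derivative f (at x) v * inverse (f x))) S" for v
      by (intro differentiable_upto_mult assms(1) Suc D c)
    then have *: "differentiable_upto n
        (\<lambda>x. - (inverse (f x) * frechet_derivative f (at x) v * inverse (f x))) S" for v
      by (simp only: mult_minus1)
    have "differentiable_upto n (\<lambda>x. frechet_derivative (\<lambda>x. inverse (f x)) (at x) v) S" for v
      by (rule differentiable_upto_cong[OF assms(1) _ *[of v]])
        (simp add: frechet_derivative_at[OF der, symmetric])
    then show ?case using der by (auto simp: differentiable_def)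
  qed
  then show ?thesis by (simp add: smooth_on_def)
qed

lemma smooth_on_vec_nth: "open S \<Longrightarrow> smooth_on f S \<Longrightarrow> smooth_on (\<lambda>x. f x $ i) S"
  by (rule smooth_on_bounded_linear[OF _ bounded_linear_vec_nth])

section \<open>Symmetry of second derivatives, by two applications of the mean value theorem\<close>

lemma smooth_on_second_difference:
  fixes f :: "'a::real_normed_vector \<Rightarrow> real"
  assumes f: "smooth_on f S" and "h > 0"
    and S: "\<And>s t. 0 \<le> s \<Longrightarrow> s \<le> h \<Longrightarrow> 0 \<le> t \<Longrightarrow> t \<le> h \<Longrightarrow> x + s *\<^sub>R u + t *\<^sub>R v \<in> S"
  obtains s t where "0 \<le> s" "s \<le> h" "0 \<le> t" "t \<le> h"
    "f (x + h *\<^sub>R u + h *\<^sub>R v) - f (x + h *\<^sub>R u) - f (x + h *\<^sub>R v) + f x =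
      h * h * frechet_derivative (\<lambda>y. frechet_derivative f (at y) u) (at (x + s *\<^sub>R u + t *\<^sub>R v)) v"
proof -
  define D where "D = (\<lambda>w f (y::'a). frechet_derivative f (at y) w :: real)"
  have lineu: "((\<lambda>s. \<phi> (x + s *\<^sub>R u + t *\<^sub>R v)) has_real_derivative D u \<phi> (x + s *\<^sub>R u + t *\<^sub>R v)) (at s)"
    and linev: "((\<lambda>t. \<phi> (x + s *\<^sub>R u + t *\<^sub>R v)) has_real_derivative D v \<phi> (x + s *\<^sub>R u + t *\<^sub>R v)) (at t)"
    if "smooth_on \<phi> S" "0 \<le> s" "s \<le> h" "0 \<le> t" "t \<le> h" for \<phi> s t
  proof -
    let ?y = "x + s *\<^sub>R u + t *\<^sub>R v"
    have d: "(\<phi> has_derivative frechet_derivative \<phi> (at ?y)) (at ?y)"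
      using smooth_on_imp_differentiable[OF that(1) S] that by (simp add: frechet_derivative_works)
    have l: "frechet_derivative \<phi> (at ?y) (c *\<^sub>R w) = D w \<phi> ?y * c" for c w
      using has_derivative_linear[OF d] by (simp add: linear_cmul D_def)
    have "((\<lambda>s. x + s *\<^sub>R u + t *\<^sub>R v) has_derivative (\<lambda>c. c *\<^sub>R u)) (at s)"
      "((\<lambda>t. x + s *\<^sub>R u + t *\<^sub>R v) has_derivative (\<lambda>c. c *\<^sub>R v)) (at t)"
      by (auto intro!: derivative_eq_intros)
    from has_derivative_compose[OF this(1) d] has_derivative_compose[OF this(2) d]
    show "((\<lambda>s. \<phi> (x + s *\<^sub>R u + t *\<^sub>R v)) has_real_derivative D u \<phi> ?y) (at s)"
      "((\<lambda>t. \<phi> (x + s *\<^sub>R u + t *\<^sub>R v)) has_real_derivative D v \<phi> ?y) (at t)"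
      by (simp_all add: l has_field_derivative_def)
  qed
  \<comment> \<open>The summand \<open>0 *\<^sub>R v\<close> puts both edges of the parallelogram
    into the form of \<open>lineu\<close>, with t = h and t = 0.\<close>
  have "((\<lambda>s. f (x + s *\<^sub>R u + h *\<^sub>R v) - f (x + s *\<^sub>R u + 0 *\<^sub>R v)) has_real_derivative
      D u f (x + s *\<^sub>R u + h *\<^sub>R v) - D u f (x + s *\<^sub>R u + 0 *\<^sub>R v)) (at s)"
    if "0 \<le> s" "s \<le> h" for s
    using that \<open>h > 0\<close> by (intro DERIV_diff lineu f) auto
  from MVT2[OF \<open>h > 0\<close> this] obtain s where s: "0 < s" "s < h"
    "f (x + h *\<^sub>R u + h *\<^sub>R v) - f (x + h *\<^sub>R u) - (f (x + h *\<^sub>R v) - f x) =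
      h * (D u f (x + s *\<^sub>R u + h *\<^sub>R v) - D u f (x + s *\<^sub>R u))"
    by auto
  have "((\<lambda>t. D u f (x + s *\<^sub>R u + t *\<^sub>R v)) has_real_derivative
      D v (D u f) (x + s *\<^sub>R u + t *\<^sub>R v)) (at t)" if "0 \<le> t" "t \<le> h" for t
    using that s by (intro linev) (auto simp: D_def intro: smooth_on_frechet_derivative f)
  from MVT2[OF \<open>h > 0\<close> this] obtain t where t: "0 < t" "t < h"
    "D u f (x + s *\<^sub>R u + h *\<^sub>R v) - D u f (x + s *\<^sub>R u) = h * D v (D u f) (x + s *\<^sub>R u + t *\<^sub>R v)"
    by auto
  show thesis
    by (rule that[of s t]) (use s t in \<open>auto simp: D_def algebra_simps\<close>)
qed

text \<open>The second difference over the parallelogram spanned by h u and h v is symmetric in u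
  and v. Hence the two mixed derivatives take a common value at points near x, and continuity
  excludes a gap at x.\<close>

lemma smooth_on_mixed_derivatives:
  fixes f :: "'a::real_normed_vector \<Rightarrow> real"
  assumes "open S" "smooth_on f S" "x \<in> S"
  shows "frechet_derivative (\<lambda>y. frechet_derivative f (at y) u) (at x) v =
    frechet_derivative (\<lambda>y. frechet_derivative f (at y) v) (at x) u"
proof (rule ccontr)
  define D where "D = (\<lambda>u v x. frechet_derivative (\<lambda>y. frechet_derivative f (at y) u) (at x) v)"
  assume "\<not> ?thesis"
  \<comment> \<open>Half of the supposed gap: numbers closer than this to \<open>D u v x\<close> and
    to \<open>D v u x\<close> respectively cannot coincide.\<close>
  then have e: "\<bar>D u v x - D v u x\<bar> / 2 > 0" (is "?e > 0") by (simp add: D_def)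
  have "isCont (D u v) x" for u v
    using smooth_on_imp_continuous_on[OF smooth_on_frechet_derivative[OF
          smooth_on_frechet_derivative[OF assms(2)]], of u v]
      assms by (simp add: D_def continuous_on_eq_continuous_at)
  then have "\<forall>\<^sub>F y in nhds x. dist (D u v y) (D u v x) < ?e" for u v
    using e tendstoD unfolding isCont_def tendsto_at_iff_tendsto_nhds by blast
  moreover have "\<forall>\<^sub>F y in nhds x. y \<in> S"
    using assms by (simp add: eventually_nhds_in_open)
  ultimately have "\<forall>\<^sub>F y in nhds x. y \<in> S \<and> dist (D u v y) (D u v x) < ?e \<and> dist (D v u y) (D v u x) < ?e"
    by (auto simp: eventually_conj_iff)
  then obtain d where d: "d > 0"
    "\<And>y. dist y x < d \<Longrightarrow> y \<in> S \<and> dist (D u v y) (D u v x) < ?e \<and> dist (D v u y) (D v u x) < ?e"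
    by (auto simp: eventually_nhds_metric)
  \<comment> \<open>With this size the whole parallelogram stays within distance d of x; the summand
    1 makes the bound strict and the denominator positive.\<close>
  define h where "h = d / (norm u + norm v + 1)"
  have np: "norm u + norm v + 1 > 0" by (simp add: add_nonneg_pos)
  have h: "h > 0" using d np by (simp add: h_def)
  have near: "dist (x + s *\<^sub>R u + t *\<^sub>R v) x < d" if "0 \<le> s" "s \<le> h" "0 \<le> t" "t \<le> h" for s t
  proof -
    have "norm (s *\<^sub>R u + t *\<^sub>R v) \<le> s * norm u + t * norm v"
      using that by (intro norm_triangle_le) simp
    also have "\<dots> \<le> h * norm u + h * norm v"
      using that by (intro add_mono mult_right_mono) auto
    also have "\<dots> < h * (norm u + norm v + 1)"
      using h by (simp add: algebra_simps)
    also have "\<dots> = d" using np by (simp add: h_def)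
    finally show ?thesis by (simp add: dist_norm)
  qed
  obtain s t where 1: "0 \<le> s" "s \<le> h" "0 \<le> t" "t \<le> h"
    "f (x + h *\<^sub>R u + h *\<^sub>R v) - f (x + h *\<^sub>R u) - f (x + h *\<^sub>R v) + f x =
      h * h * D u v (x + s *\<^sub>R u + t *\<^sub>R v)"
    using smooth_on_second_difference[OF assms(2) h, of x u v] d near unfolding D_def by metis
  have near': "dist (x + s *\<^sub>R v + t *\<^sub>R u) x < d" if "0 \<le> s" "s \<le> h" "0 \<le> t" "t \<le> h" for s t
    using near[of t s] that by (simp add: algebra_simps)
  obtain s' t' where 2: "0 \<le> s'" "s' \<le> h" "0 \<le> t'" "t' \<le> h"
    "f (x + h *\<^sub>R v + h *\<^sub>R u) - f (x + h *\<^sub>R v) - f (x + h *\<^sub>R u) + f x =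
      h * h * D v u (x + s' *\<^sub>R v + t' *\<^sub>R u)"
    using smooth_on_second_difference[OF assms(2) h, of x v u] d near' unfolding D_def by metis
  have "h * h * D u v (x + s *\<^sub>R u + t *\<^sub>R v) = h * h * D v u (x + s' *\<^sub>R v + t' *\<^sub>R u)"
    using 1(5) 2(5) by (simp add: algebra_simps)
  then have "D u v (x + s *\<^sub>R u + t *\<^sub>R v) = D v u (x + s' *\<^sub>R v + t' *\<^sub>R u)"
    using h by simp
  moreover have "dist (D u v (x + s *\<^sub>R u + t *\<^sub>R v)) (D u v x) < ?e"
    "dist (D v u (x + s' *\<^sub>R v + t' *\<^sub>R u)) (D v u x) < ?e"
    using d(2)[OF near[OF 1(1-4)]] d(2)[OF near'[OF 2(1-4)]] by auto
  ultimately show False by (simp add: dist_real_def) argo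
qed


section \<open>Partial derivatives\<close>

lemma pderiv_at_commute:
  assumes "open S" "smooth_on f S" "x \<in> S"
  shows "pderiv_at i (pderiv_at j f) x = pderiv_at j (pderiv_at i f) x"
  using smooth_on_mixed_derivatives[OF assms, of "axis j 1" "axis i 1"] by (simp add: pderiv_at_def[abs_def])

lemma pderiv_at_eqI: "(f has_derivative f') (at x) \<Longrightarrow> pderiv_at i f x = f' (axis i 1)"
  unfolding pderiv_at_def by (metis frechet_derivative_at)

text \<open>No differentiability is assumed: if f has no derivative at x then neither has g, and
  \<open>frechet_derivative\<close> makes the same default choice for both.\<close>

lemma pderiv_at_cong:
  assumes "open S" "x \<in> S" "\<And>y. y \<in> S \<Longrightarrow> f y = g y"
  shows "pderiv_at i f x = pderiv_at i g x"
proof (cases "f differentiable (at x)")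
  case True
  then show ?thesis
    using frechet_derivative_transform_within_open[OF True assms(1,2)] assms(3) by (simp add: pderiv_at_def)
next
  case False
  then have "(f has_derivative f') (at x) \<longleftrightarrow> (g has_derivative f') (at x)" for f'
    using has_derivative_transform_within_open[OF _ assms(1,2)] assms(3) by metis
  then show ?thesis by (simp add: pderiv_at_def frechet_derivative_def)
qed

lemma pderiv_at_const [simp]: "pderiv_at i (\<lambda>x. c) x = 0"
  by (simp add: pderiv_at_def)

lemma pderiv_at_add:
  assumes "f differentiable (at x)" "g differentiable (at x)"
  shows "pderiv_at i (\<lambda>x. f x + g x) x = pderiv_at i f x + pderiv_at i g x"
  using pderiv_at_eqI[OF has_derivative_add[OF assms[unfolded frechet_derivative_works]]]
  by (simp add: pderiv_at_def)

lemma pderiv_at_mult: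
  assumes "f differentiable (at x)" "g differentiable (at x)"
  shows "pderiv_at i (\<lambda>x. f x * g x) x = pderiv_at i f x * g x + f x * pderiv_at i g x"
  using pderiv_at_eqI[OF has_derivative_mult[OF assms[unfolded frechet_derivative_works]]]
  by (simp add: pderiv_at_def)

lemma pderiv_at_minus:
  assumes "f differentiable (at x)"
  shows "pderiv_at i (\<lambda>x. - f x) x = - pderiv_at i f x"
  using pderiv_at_eqI[OF has_derivative_minus[OF assms[unfolded frechet_derivative_works]]]
  by (simp add: pderiv_at_def)

lemma pderiv_at_diff:
  assumes "f differentiable (at x)" "g differentiable (at x)"
  shows "pderiv_at i (\<lambda>x. f x - g x) x = pderiv_at i f x - pderiv_at i g x"
  using pderiv_at_eqI[OF has_derivative_diff[OF assms[unfolded frechet_derivative_works]]]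
  by (simp add: pderiv_at_def)

lemma pderiv_at_sum:
  assumes "\<And>k. k \<in> I \<Longrightarrow> f k differentiable (at x)"
  shows "pderiv_at i (\<lambda>x. \<Sum>k\<in>I. f k x) x = (\<Sum>k\<in>I. pderiv_at i (f k) x)"
  using pderiv_at_eqI[OF has_derivative_sum[OF assms[unfolded frechet_derivative_works]]]
  by (simp add: pderiv_at_def)

lemma jacobian_nth:
  assumes "F differentiable (at x)"
  shows "jacobian F x $ a $ i = pderiv_at i (\<lambda>y. F y $ a) x"
  using pderiv_at_eqI[OF bounded_linear.has_derivative[OF bounded_linear_vec_nth
        assms[unfolded frechet_derivative_works]]]
  by (simp add: jacobian_def matrix_def)

lemma frechet_derivative_eq_sum_pderiv_at:
  fixes f :: "real^'l::finite \<Rightarrow> real"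
  assumes "f differentiable (at x)"
  shows "frechet_derivative f (at x) w = (\<Sum>a\<in>UNIV. pderiv_at a f x * w $ a)"
proof -
  have lin: "linear (frechet_derivative f (at x))"
    using assms has_derivative_linear frechet_derivative_works by blast
  have "w = (\<Sum>a\<in>UNIV. w $ a *\<^sub>R axis a 1)"
    by (simp add: vec_eq_iff axis_def if_distrib cong: if_cong)
  then have "frechet_derivative f (at x) w = frechet_derivative f (at x) (\<Sum>a\<in>UNIV. w $ a *\<^sub>R axis a 1)"
    by simp
  also have "\<dots> = (\<Sum>a\<in>UNIV. pderiv_at a f x * w $ a)"
    by (simp add: linear_sum[OF lin] linear_cmul[OF lin] pderiv_at_def mult.commute)
  finally show ?thesis .
qed

lemma pderiv_at_compose:
  fixes f :: "real^'l::finite \<Rightarrow> real" and F :: "real^'k::finite \<Rightarrow> real^'l"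
  assumes "F differentiable (at x)" "f differentiable (at (F x))"
  shows "pderiv_at i (\<lambda>y. f (F y)) x = (\<Sum>a\<in>UNIV. pderiv_at a f (F x) * jacobian F x $ a $ i)"
  using pderiv_at_eqI[OF has_derivative_compose[OF assms[unfolded frechet_derivative_works]]]
    frechet_derivative_eq_sum_pderiv_at[OF assms(2)]
  by (simp add: jacobian_def matrix_def)

text \<open>By the chain rule the derivative of f o F is a sum of products of a partial derivative
  of f, again composed with F, and a component of the derivative of F. The induction thus varies f
  and keeps F.\<close>

lemma smooth_on_compose:
  fixes f :: "real^'l::finite \<Rightarrow> real" and F :: "real^'k::finite \<Rightarrow> real^'l"
  assumes "open U" "open V" "smooth_on F U" "F ` U \<subseteq> V" "smooth_on f V"
  shows "smooth_on (\<lambda>x. f (F x)) U"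
proof -
  have "differentiable_upto n (\<lambda>x. f (F x)) U" for n
    using assms(5)
  proof (induction n arbitrary: f)
    case 0
    have "continuous_on U F" "continuous_on (F ` U) f"
      using assms(3,4) 0 smooth_on_imp_continuous_on continuous_on_subset by blast+
    then show ?case by (simp add: continuous_on_compose2)
  next
    case (Suc n)
    have dF: "(F has_derivative frechet_derivative F (at x)) (at x)"
      and df: "(f has_derivative frechet_derivative f (at (F x))) (at (F x))" if "x \<in> U" for x
      using that assms(3,4) Suc.prems smooth_on_imp_differentiable frechet_derivative_works by blast+
    have der: "((\<lambda>x. f (F x)) has_derivative
        (\<lambda>v. frechet_derivative f (at (F x)) (frechet_derivative F (at x) v))) (at x)"
      if "x \<in> U" for x
      using has_derivative_compose[OF dF[OF that] df[OF that]] .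
    have F': "differentiable_upto n (\<lambda>x. frechet_derivative F (at x) v $ a) U" for v a
      using smooth_on_vec_nth[OF assms(1) smooth_on_frechet_derivative[OF assms(3)]]
      by (auto simp: smooth_on_def)
    \<comment> \<open>Sums are needed at the fixed order n here, whereas
      \<open>smooth_on_sum\<close> speaks of all orders at once.\<close>
    have sums: "differentiable_upto n (\<lambda>x. \<Sum>a\<in>I. h a x) U"
      if "\<And>a. differentiable_upto n (h a) U" for I :: "'l set" and h :: "'l \<Rightarrow> real^'k \<Rightarrow> real"
      by (induction I rule: infinite_finite_induct)
        (use that smooth_on_const[of "0::real" U] in \<open>auto simp: smooth_on_def intro: differentiable_upto_add assms(1)\<close>)
    have *: "differentiable_upto n
        (\<lambda>x. \<Sum>a\<in>UNIV. pderiv_at a f (F x) * frechet_derivative F (at x) v $ a) U" for v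
      by (intro sums differentiable_upto_mult assms(1) F' Suc.IH smooth_on_pderiv_at Suc.prems)
    have "differentiable_upto n (\<lambda>x. frechet_derivative (\<lambda>x. f (F x)) (at x) v) U" for v
      by (rule differentiable_upto_cong[OF assms(1) _ *[of v]])
        (simp add: frechet_derivative_at[OF der, symmetric]
          frechet_derivative_eq_sum_pderiv_at[OF differentiableI[OF df]])
    then show ?case using der by (auto simp: differentiable_def)
  qed
  then show ?thesis by (simp add: smooth_on_def)
qed


section \<open>Matrix calculus\<close>

lemma matrix_add_rdistrib: "(B + C) ** A = B ** A + C ** A" for A :: "real^'n^'m" and B :: "real^'m^'p"
  by (simp add: matrix_matrix_mult_def vec_eq_iff sum.distrib distrib_right)

lemma matrix_diff_ldistrib: "A ** (B - C) = A ** B - A ** (C :: real^'p^'n)" for A :: "real^'n^'m"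
  by (simp add: matrix_matrix_mult_def vec_eq_iff sum_subtractf right_diff_distrib)

lemma matrix_diff_rdistrib: "(B - C) ** A = B ** A - C ** A" for A :: "real^'n^'m" and B :: "real^'m^'p"
  by (simp add: matrix_matrix_mult_def vec_eq_iff sum_subtractf left_diff_distrib)

lemma matrix_minus_mult_left: "(- B) ** A = - (B ** A)" for A :: "real^'n^'m" and B :: "real^'m^'p"
  using matrix_diff_rdistrib[of 0 B A] by simp

lemma matrix_minus_mult_right: "B ** (- A) = - (B ** A)" for A :: "real^'n^'m" and B :: "real^'m^'p"
  using matrix_diff_ldistrib[of B 0 A] by simp

lemma transpose_add: "transpose (A + B) = transpose A + transpose (B :: real^'n^'m)"
  by (simp add: transpose_def vec_eq_iff)

lemma transpose_diff: "transpose (A - B) = transpose A - transpose (B :: real^'n^'m)"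
  by (simp add: transpose_def vec_eq_iff)

lemma transpose_minus: "transpose (- A) = - transpose (A :: real^'n^'m)"
  by (simp add: transpose_def vec_eq_iff)

lemmas matrix_ring_simps = matrix_add_ldistrib matrix_add_rdistrib matrix_diff_ldistrib
  matrix_diff_rdistrib matrix_minus_mult_left matrix_minus_mult_right matrix_mul_assoc

lemmas transpose_simps = transpose_add transpose_diff transpose_minus matrix_transpose_mul transpose_transpose

lemma matrix_mult_nth: "(A ** B) $ i $ j = (\<Sum>k\<in>UNIV. A $ i $ k * B $ k $ j)"
  by (simp add: matrix_matrix_mult_def)

text \<open>Entrywise, so that the product, quotient and chain rules for real-valued functions apply
  directly.\<close>

definition smooth_matrix_on :: "(real^'k::finite \<Rightarrow> real^'n^'m) \<Rightarrow> (real^'k) set \<Rightarrow> bool" where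
  "smooth_matrix_on M S \<longleftrightarrow> (\<forall>a b. smooth_on (\<lambda>x. M x $ a $ b) S)"

definition matrix_pderiv :: "'k::finite \<Rightarrow> (real^'k \<Rightarrow> real^'n^'m) \<Rightarrow> real^'k \<Rightarrow> real^'n^'m" where
  "matrix_pderiv i M x = (\<chi> a b. pderiv_at i (\<lambda>y. M y $ a $ b) x)"

lemma smooth_matrix_onD:
  "smooth_matrix_on M S \<Longrightarrow> x \<in> S \<Longrightarrow> (\<lambda>x. M x $ a $ b) differentiable (at x)"
  by (auto simp: smooth_matrix_on_def intro: smooth_on_imp_differentiable)

lemma smooth_matrix_on_nth: "smooth_matrix_on M S \<Longrightarrow> smooth_on (\<lambda>x. M x $ a $ b) S"
  by (simp add: smooth_matrix_on_def)

lemma smooth_matrix_on_subset: "smooth_matrix_on M S \<Longrightarrow> T \<subseteq> S \<Longrightarrow> smooth_matrix_on M T"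
  unfolding smooth_matrix_on_def smooth_on_def using differentiable_upto_subset by blast

lemma smooth_matrix_on_smooth_on: "open S \<Longrightarrow> smooth_on M S \<Longrightarrow> smooth_matrix_on M S"
  by (auto simp: smooth_matrix_on_def intro!: smooth_on_vec_nth)

lemma smooth_matrix_on_add:
  "open S \<Longrightarrow> smooth_matrix_on M S \<Longrightarrow> smooth_matrix_on N S \<Longrightarrow> smooth_matrix_on (\<lambda>x. M x + N x) S"
  by (auto simp: smooth_matrix_on_def intro: smooth_on_add)

lemma smooth_matrix_on_diff:
  "open S \<Longrightarrow> smooth_matrix_on M S \<Longrightarrow> smooth_matrix_on N S \<Longrightarrow> smooth_matrix_on (\<lambda>x. M x - N x) S"
  by (auto simp: smooth_matrix_on_def intro: smooth_on_diff)

lemma smooth_matrix_on_mult: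
  "open S \<Longrightarrow> smooth_matrix_on M S \<Longrightarrow> smooth_matrix_on N S \<Longrightarrow> smooth_matrix_on (\<lambda>x. M x ** N x) S"
  unfolding smooth_matrix_on_def matrix_mult_nth by (intro allI smooth_on_sum smooth_on_mult) auto

lemma smooth_matrix_on_transpose:
  "smooth_matrix_on M S \<Longrightarrow> smooth_matrix_on (\<lambda>x. transpose (M x)) S"
  by (auto simp: smooth_matrix_on_def transpose_def)

lemma smooth_matrix_on_scaleR:
  "open S \<Longrightarrow> smooth_on f S \<Longrightarrow> smooth_matrix_on M S \<Longrightarrow> smooth_matrix_on (\<lambda>x. f x *\<^sub>R M x) S"
  by (auto simp: smooth_matrix_on_def intro: smooth_on_mult)

lemma smooth_matrix_on_const: "smooth_matrix_on (\<lambda>x. M) S"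
  by (auto simp: smooth_matrix_on_def intro: smooth_on_const)

lemma smooth_matrix_on_pderiv: "smooth_matrix_on M S \<Longrightarrow> smooth_matrix_on (matrix_pderiv i M) S"
  by (auto simp: smooth_matrix_on_def matrix_pderiv_def intro: smooth_on_pderiv_at)

lemma smooth_matrix_on_compose:
  assumes "open U" "open V" "smooth_on F U" "F ` U \<subseteq> V" "smooth_matrix_on M V"
  shows "smooth_matrix_on (\<lambda>x. M (F x)) U"
  unfolding smooth_matrix_on_def
  by (intro allI smooth_on_compose[OF assms(1-4)] smooth_matrix_on_nth[OF assms(5)])

lemma smooth_on_det:
  assumes "open S" "smooth_matrix_on M S"
  shows "smooth_on (\<lambda>x. det (M x)) S"
  unfolding det_def using assms
  by (intro smooth_on_sum smooth_on_mult smooth_on_prod smooth_on_const smooth_matrix_on_nth) auto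

lemma matrix_inv_left: "det A \<noteq> 0 \<Longrightarrow> matrix_inv A ** A = mat 1"
  and matrix_inv_right: "det A \<noteq> 0 \<Longrightarrow> A ** matrix_inv A = mat 1" for A :: "real^'n^'n"
proof -
  assume "det A \<noteq> 0"
  then have "\<exists>B. A ** B = mat 1 \<and> B ** A = mat 1"
    by (simp add: invertible_det_nz[symmetric] invertible_def)
  from someI_ex[OF this] show "matrix_inv A ** A = mat 1" "A ** matrix_inv A = mat 1"
    unfolding matrix_inv_def by auto
qed

text \<open>Cramer's rule. It exhibits the entries of the inverse as quotients of polynomials in the
  entries of A, which is why inverses of smooth matrix functions are smooth.\<close>

lemma matrix_inv_nth:
  fixes A :: "real^'n^'n"
  assumes "det A \<noteq> 0"
  shows "matrix_inv A $ k $ l = det (\<chi> i j. if j = k then mat 1 $ i $ l else A $ i $ j) / det A"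
proof -
  let ?b = "(\<chi> i. mat 1 $ i $ l) :: real^'n"
  let ?x = "\<chi> k. matrix_inv A $ k $ l"
  have "(A *v ?x) $ i = (A ** matrix_inv A) $ i $ l" for i
    by (simp add: matrix_vector_mult_def matrix_matrix_mult_def)
  then have "A *v ?x = ?b"
    by (simp only: matrix_inv_right[OF assms]) (simp add: vec_eq_iff)
  then have "?x = (\<chi> k. det (\<chi> i j. if j = k then ?b $ i else A $ i $ j) / det A)"
    using cramer[OF assms] by blast
  then have "?x $ k = (\<chi> k. det (\<chi> i j. if j = k then ?b $ i else A $ i $ j) / det A) $ k" by simp
  then show ?thesis by (simp cong: if_cong)
qed

lemma smooth_matrix_on_inv:
  assumes "open S" "smooth_matrix_on M S" "\<And>x. x \<in> S \<Longrightarrow> det (M x) \<noteq> 0"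
  shows "smooth_matrix_on (\<lambda>x. matrix_inv (M x)) S"
  unfolding smooth_matrix_on_def
proof (intro allI)
  fix k l
  have "smooth_on (\<lambda>x. if b = k then mat 1 $ a $ l else M x $ a $ b) S" for a b
    by (cases "b = k") (simp_all add: smooth_on_const smooth_matrix_on_nth[OF assms(2)])
  then have "smooth_matrix_on (\<lambda>x. \<chi> i j. if j = k then mat 1 $ i $ l else M x $ i $ j) S"
    by (simp add: smooth_matrix_on_def)
  then have "smooth_on (\<lambda>x. det (\<chi> i j. if j = k then mat 1 $ i $ l else M x $ i $ j) * inverse (det (M x))) S"
    by (intro smooth_on_mult smooth_on_inverse smooth_on_det assms)
  then show "smooth_on (\<lambda>x. matrix_inv (M x) $ k $ l) S"
    by (rule smooth_on_cong[OF assms(1)]) (simp add: matrix_inv_nth[OF assms(3)] divide_inverse)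
qed

lemma matrix_pderiv_cong:
  assumes "open S" "x \<in> S" "\<And>y. y \<in> S \<Longrightarrow> M y = N y"
  shows "matrix_pderiv i M x = matrix_pderiv i N x"
  by (auto simp: matrix_pderiv_def vec_eq_iff assms(3) intro!: pderiv_at_cong[OF assms(1,2)])

lemma matrix_pderiv_const [simp]: "matrix_pderiv i (\<lambda>x. M) x = 0"
  by (simp add: matrix_pderiv_def vec_eq_iff)

lemma matrix_pderiv_transpose: "matrix_pderiv i (\<lambda>x. transpose (M x)) x = transpose (matrix_pderiv i M x)"
  by (simp add: matrix_pderiv_def transpose_def vec_eq_iff)

lemma matrix_pderiv_add:
  assumes "smooth_matrix_on M S" "smooth_matrix_on N S" "x \<in> S"
  shows "matrix_pderiv i (\<lambda>x. M x + N x) x = matrix_pderiv i M x + matrix_pderiv i N x"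
  using smooth_matrix_onD[OF assms(1,3)] smooth_matrix_onD[OF assms(2,3)]
  by (simp add: matrix_pderiv_def vec_eq_iff pderiv_at_add)

lemma matrix_pderiv_diff:
  assumes "smooth_matrix_on M S" "smooth_matrix_on N S" "x \<in> S"
  shows "matrix_pderiv i (\<lambda>x. M x - N x) x = matrix_pderiv i M x - matrix_pderiv i N x"
  using smooth_matrix_onD[OF assms(1,3)] smooth_matrix_onD[OF assms(2,3)]
  by (simp add: matrix_pderiv_def vec_eq_iff pderiv_at_diff)

lemma matrix_pderiv_minus:
  assumes "smooth_matrix_on M S" "x \<in> S"
  shows "matrix_pderiv i (\<lambda>x. - M x) x = - matrix_pderiv i M x"
  using smooth_matrix_onD[OF assms]
  by (simp add: matrix_pderiv_def vec_eq_iff pderiv_at_minus)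

lemma matrix_pderiv_mult:
  assumes "smooth_matrix_on M S" "smooth_matrix_on N S" "x \<in> S"
  shows "matrix_pderiv i (\<lambda>x. M x ** N x) x = matrix_pderiv i M x ** N x + M x ** matrix_pderiv i N x"
  using smooth_matrix_onD[OF assms(1,3)] smooth_matrix_onD[OF assms(2,3)]
  by (simp add: matrix_pderiv_def vec_eq_iff matrix_mult_nth pderiv_at_sum pderiv_at_mult sum.distrib)

lemma matrix_pderiv_scaleR:
  assumes "smooth_on f S" "smooth_matrix_on M S" "x \<in> S"
  shows "matrix_pderiv i (\<lambda>x. f x *\<^sub>R M x) x = pderiv_at i f x *\<^sub>R M x + f x *\<^sub>R matrix_pderiv i M x"
  using smooth_on_imp_differentiable[OF assms(1,3)] smooth_matrix_onD[OF assms(2,3)]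
  by (simp add: matrix_pderiv_def vec_eq_iff pderiv_at_mult)

lemma matrix_pderiv_commute:
  assumes "open S" "smooth_matrix_on M S" "x \<in> S"
  shows "matrix_pderiv i (matrix_pderiv j M) x = matrix_pderiv j (matrix_pderiv i M) x"
  using pderiv_at_commute[OF assms(1) smooth_matrix_on_nth[OF assms(2)] assms(3)]
  by (simp add: matrix_pderiv_def vec_eq_iff)


section \<open>Connection and curvature matrices\<close>

text \<open>The connection matrix \<open>A_i\<close>: rows carry the upper index, so a vector field
  with component vector v has covariant derivative \<open>d_i v + A_i v\<close>. The matrices
  \<open>curv G i j\<close> follow the same convention and represent R(d_i, d_j) as an
  endomorphism.\<close>

definition conn :: "(real^'n::finite \<Rightarrow> real^'n^'n) \<Rightarrow> 'n \<Rightarrow> real^'n \<Rightarrow> real^'n^'n" where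
  "conn G i x = (\<chi> l k. christoffel G x l i k)"

definition curv :: "(real^'n::finite \<Rightarrow> real^'n^'n) \<Rightarrow> 'n \<Rightarrow> 'n \<Rightarrow> real^'n \<Rightarrow> real^'n^'n" where
  "curv G i j x = (\<chi> l k. riemann G x l k i j)"

lemma curv_eq:
  "curv G i j = (\<lambda>x. matrix_pderiv i (conn G j) x - matrix_pderiv j (conn G i) x
     + (conn G i x ** conn G j x - conn G j x ** conn G i x))"
  by (simp add: curv_def conn_def riemann_def matrix_pderiv_def vec_eq_iff fun_eq_iff matrix_mult_nth
      sum_subtractf)

lemma curv_swap: "curv G j i x = - curv G i j x"
  by (simp add: curv_eq)

lemma ricci_form_eq: "ricci_form G x $ j $ k = (\<Sum>a\<in>UNIV. curv G a j x $ a $ k)"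
  by (simp add: ricci_form_def curv_def)

lemma scal_eq: "scal G x = trace (matrix_inv (G x) ** ricci_form G x)"
  by (simp add: scal_def ricci_endo_def)

text \<open>The set U is a parameter because the same Gram matrix function is considered both on a
  full chart image and on the image of an overlap of two charts.\<close>

locale local_metric =
  fixes U :: "(real^'n::finite) set" and G :: "real^'n \<Rightarrow> real^'n^'n"
  assumes open_U: "open U" and smooth_G: "smooth_matrix_on G U"
    and sym_G: "x \<in> U \<Longrightarrow> transpose (G x) = G x"
    and pos_G: "x \<in> U \<Longrightarrow> v \<noteq> 0 \<Longrightarrow> v \<bullet> (G x *v v) > 0"
begin

abbreviation P :: "real^'n \<Rightarrow> real^'n^'n" where "P x \<equiv> matrix_inv (G x)"

lemma det_G: "x \<in> U \<Longrightarrow> det (G x) \<noteq> 0"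
proof -
  assume x: "x \<in> U"
  have "v = 0" if "G x *v v = 0" for v
    using pos_G[OF x, of v] that by auto
  then have "invertible (G x)"
    unfolding invertible_left_inverse matrix_left_invertible_ker by blast
  then show ?thesis by (simp add: invertible_det_nz)
qed

lemma P_G: "x \<in> U \<Longrightarrow> P x ** G x = mat 1" and G_P: "x \<in> U \<Longrightarrow> G x ** P x = mat 1"
  by (simp_all add: det_G matrix_inv_left matrix_inv_right)

lemma sym_P: "x \<in> U \<Longrightarrow> transpose (P x) = P x"
proof -
  assume x: "x \<in> U"
  have "transpose (P x) ** G x = mat 1"
    using arg_cong[OF G_P[OF x], of transpose] sym_G[OF x] by (simp add: matrix_transpose_mul)
  then have "transpose (P x) ** (G x ** P x) = P x"
    by (simp add: matrix_mul_assoc)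
  then show ?thesis using G_P[OF x] by simp
qed

lemma sym_G_nth: "x \<in> U \<Longrightarrow> G x $ i $ j = G x $ j $ i"
  using sym_G[of x] by (simp add: transpose_def vec_eq_iff)

lemma sym_P_nth: "x \<in> U \<Longrightarrow> P x $ i $ j = P x $ j $ i"
  using sym_P[of x] by (simp add: transpose_def vec_eq_iff)

lemma smooth_P: "smooth_matrix_on P U"
  by (intro smooth_matrix_on_inv open_U smooth_G det_G)

lemma smooth_conn: "smooth_matrix_on (conn G i) U"
  unfolding smooth_matrix_on_def conn_def christoffel_def divide_inverse vec_lambda_beta
  by (intro allI smooth_on_sum smooth_on_mult smooth_on_add smooth_on_diff smooth_on_const open_U
      smooth_on_pderiv_at smooth_matrix_on_nth[OF smooth_G] smooth_matrix_on_nth[OF smooth_P])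

lemma smooth_curv: "smooth_matrix_on (curv G i j) U"
  unfolding curv_eq
  by (intro smooth_matrix_on_add smooth_matrix_on_diff smooth_matrix_on_mult smooth_matrix_on_pderiv
      smooth_conn open_U)

lemma smooth_ricci_form: "smooth_matrix_on (ricci_form G) U"
  unfolding smooth_matrix_on_def ricci_form_eq
  by (intro allI smooth_on_sum smooth_matrix_on_nth smooth_curv open_U)

lemma smooth_ricci_endo: "smooth_matrix_on (ricci_endo G) U"
  unfolding ricci_endo_def by (intro smooth_matrix_on_mult open_U smooth_P smooth_ricci_form)

lemma smooth_scal: "smooth_on (scal G) U"
  unfolding scal_def trace_def
  by (intro smooth_on_sum smooth_matrix_on_nth smooth_ricci_endo open_U)

section \<open>The Levi-Civita connection: symmetry, compatibility, uniqueness\<close>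

lemma pderiv_G_sym: "x \<in> U \<Longrightarrow> pderiv_at k (\<lambda>y. G y $ i $ j) x = pderiv_at k (\<lambda>y. G y $ j $ i) x"
  by (rule pderiv_at_cong[OF open_U]) (auto intro: sym_G_nth)

lemma conn_sym: "x \<in> U \<Longrightarrow> conn G i x $ l $ k = conn G k x $ l $ i"
  by (simp add: conn_def christoffel_def pderiv_G_sym[of x _ i k] add.commute)

text \<open>Lowering the upper index cancels the inverse metric and leaves the Christoffel symbols
  of the first kind.\<close>

lemma G_conn:
  assumes "x \<in> U"
  shows "(G x ** conn G i x) $ l $ k =
    (pderiv_at i (\<lambda>y. G y $ k $ l) x + pderiv_at k (\<lambda>y. G y $ i $ l) x - pderiv_at l (\<lambda>y. G y $ i $ k) x) / 2"
proof -
  let ?c = "(\<chi> l k. (pderiv_at i (\<lambda>y. G y $ k $ l) x + pderiv_at k (\<lambda>y. G y $ i $ l) x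
      - pderiv_at l (\<lambda>y. G y $ i $ k) x) / 2) :: real^'n^'n"
  have "conn G i x = P x ** ?c"
    by (simp add: conn_def christoffel_def vec_eq_iff matrix_mult_nth sum_divide_distrib)
  then have "G x ** conn G i x = ?c"
    by (simp add: matrix_mul_assoc G_P[OF assms])
  then show ?thesis by simp
qed

text \<open>Symmetrizing the symbols of the first kind in the lowered index and the second lower
  index cancels all but the derivative of G in direction i.\<close>

lemma metric_compatible:
  assumes "x \<in> U"
  shows "matrix_pderiv i G x = transpose (conn G i x) ** G x + G x ** conn G i x"
proof -
  have "(transpose (conn G i x) ** G x) $ j $ k = (G x ** conn G i x) $ k $ j" for j k
    by (simp add: matrix_mult_nth transpose_def sym_G_nth[OF assms, of _ k] mult.commute)
  then show ?thesis
    by (simp add: vec_eq_iff G_conn[OF assms] matrix_pderiv_def pderiv_G_sym[OF assms, of _ _ i]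
        pderiv_G_sym[OF assms, of i] field_simps)
qed

text \<open>Koszul's argument: compatibility and symmetry determine the index-lowered coefficients
  as an alternating sum of first derivatives of G. It works at the single point x, so C is a family
  of matrices and not of functions.\<close>

lemma levi_civita_unique:
  assumes x: "x \<in> U" and sym: "\<And>i k l. C i $ l $ k = C k $ l $ i"
    and compat: "\<And>i. matrix_pderiv i G x = transpose (C i) ** G x + G x ** C i"
  shows "C i = conn G i x"
proof -
  define c where "c i j k = (G x ** C i) $ j $ k" for i j k
  have csym: "c i j k = c k j i" for i j k
    unfolding c_def matrix_mult_nth by (subst sym) simp
  have "(transpose (C i) ** G x) $ j $ k = c i k j" for i j k
    by (simp add: c_def matrix_mult_nth transpose_def sym_G_nth[OF x, of _ k] mult.commute)
  then have d: "pderiv_at i (\<lambda>y. G y $ j $ k) x = c i k j + c i j k" for i j k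
    using arg_cong[OF compat[of i], of "\<lambda>M. M $ j $ k"] by (simp add: matrix_pderiv_def c_def)
  have "(G x ** C i) $ l $ k = (G x ** conn G i x) $ l $ k" for l k
    unfolding G_conn[OF x] d using csym[of i l k] csym[of i k l] csym[of k i l]
    by (simp add: c_def[symmetric])
  then have "G x ** C i = G x ** conn G i x"
    by (simp add: vec_eq_iff)
  then have "P x ** (G x ** C i) = P x ** (G x ** conn G i x)"
    by simp
  then show ?thesis by (simp add: matrix_mul_assoc P_G[OF x])
qed

section \<open>Curvature identities, up to the contracted Bianchi identity\<close>

lemma matrix_pderiv_P:
  assumes "x \<in> U"
  shows "matrix_pderiv i P x = - (conn G i x ** P x + P x ** transpose (conn G i x))"
proof -
  \<comment> \<open>Differentiating P G = 1 turns compatibility with G into compatibility with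
    P.\<close>
  have "matrix_pderiv i (\<lambda>y. P y ** G y) x = matrix_pderiv i (\<lambda>y. mat 1) x"
    by (rule matrix_pderiv_cong[OF open_U assms]) (simp add: P_G)
  then have "matrix_pderiv i P x ** G x = - (P x ** matrix_pderiv i G x)"
    by (simp add: matrix_pderiv_mult[OF smooth_P smooth_G assms] eq_neg_iff_add_eq_0)
  then have "matrix_pderiv i P x ** G x ** P x = - (P x ** matrix_pderiv i G x) ** P x"
    by simp
  then have "matrix_pderiv i P x = - (P x ** matrix_pderiv i G x ** P x)"
    by (simp add: matrix_mul_assoc[symmetric] G_P[OF assms] matrix_ring_simps(5))
  also have "P x ** matrix_pderiv i G x ** P x =
      P x ** transpose (conn G i x) ** (G x ** P x) + (P x ** G x) ** conn G i x ** P x"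
    by (simp add: metric_compatible[OF assms] matrix_ring_simps)
  finally show ?thesis by (simp add: G_P[OF assms] P_G[OF assms] add.commute)
qed

text \<open>P is parallel, so differentiating the first-order equation of
  \<open>matrix_pderiv_P\<close> once more and equating the two mixed second derivatives leaves
  exactly the action of the curvature on P, which must be zero.\<close>

lemma curv_P_antisym:
  assumes x: "x \<in> U"
  shows "curv G a b x ** P x + transpose (curv G a b x ** P x) = 0"
proof -
  let ?A = "\<lambda>i. conn G i x" and ?D = "\<lambda>i j. matrix_pderiv i (conn G j) x"
  have dd: "matrix_pderiv b (matrix_pderiv a P) x =
      - (?D b a ** P x + ?A a ** matrix_pderiv b P x + (matrix_pderiv b P x ** transpose (?A a)
         + P x ** transpose (?D b a)))" for a b
  proof -
    have "matrix_pderiv b (matrix_pderiv a P) x =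
        matrix_pderiv b (\<lambda>y. - (conn G a y ** P y + P y ** transpose (conn G a y))) x"
      by (rule matrix_pderiv_cong[OF open_U x]) (rule matrix_pderiv_P)
    also have "\<dots> = - (matrix_pderiv b (\<lambda>y. conn G a y ** P y) x
        + matrix_pderiv b (\<lambda>y. P y ** transpose (conn G a y)) x)"
      by (simp add: matrix_pderiv_minus[OF smooth_matrix_on_add x] matrix_pderiv_add[OF _ _ x] open_U
          smooth_matrix_on_mult smooth_P smooth_conn smooth_matrix_on_transpose del: minus_add_distrib)
    finally show ?thesis
      by (simp add: matrix_pderiv_mult[OF _ _ x] smooth_P smooth_conn smooth_matrix_on_transpose
          matrix_pderiv_transpose)
  qed
  have "matrix_pderiv b (matrix_pderiv a P) x = matrix_pderiv a (matrix_pderiv b P) x"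
    by (rule matrix_pderiv_commute[OF open_U smooth_P x])
  then show ?thesis
    unfolding dd matrix_pderiv_P[OF x] curv_eq
    by (simp add: matrix_ring_simps transpose_simps sym_P[OF x] algebra_simps)
qed

text \<open>The endomorphism \<open>(\<nabla>_m R)(d_a, d_b)\<close>: the commutator with
  \<open>A_m\<close> takes care of the two endomorphism indices, the two sums correct for the form
  indices a and b.\<close>

definition cov_curv :: "'n \<Rightarrow> 'n \<Rightarrow> 'n \<Rightarrow> real^'n \<Rightarrow> real^'n^'n" where
  "cov_curv m a b x = matrix_pderiv m (curv G a b) x + conn G m x ** curv G a b x - curv G a b x ** conn G m x
     - (\<Sum>p\<in>UNIV. conn G m x $ p $ a *\<^sub>R curv G p b x) - (\<Sum>p\<in>UNIV. conn G m x $ p $ b *\<^sub>R curv G a p x)"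

text \<open>In the cyclic sum the corrections for the form indices cancel in pairs because the
  connection is symmetric. What remains cancels by commuting second derivatives of the
  \<open>A_i\<close> and associativity of the matrix product.\<close>

lemma second_bianchi:
  assumes x: "x \<in> U"
  shows "cov_curv m a b x + cov_curv a b m x + cov_curv b m a x = 0"
proof -
  let ?A = "\<lambda>i. conn G i x" and ?D = "\<lambda>i j. matrix_pderiv i (conn G j) x"
  let ?E = "\<lambda>i j k. matrix_pderiv i (matrix_pderiv j (conn G k)) x"
  define T where "T m a b = (\<Sum>p\<in>UNIV. conn G m x $ p $ a *\<^sub>R curv G p b x)" for m a b
  have T1: "T m a b = T a m b" for m a b
    unfolding T_def using conn_sym[OF x] by metis
  have T2: "(\<Sum>p\<in>UNIV. conn G m x $ p $ b *\<^sub>R curv G a p x) = - T m b a" for m a b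
    unfolding T_def sum_negf[symmetric] by (subst curv_swap) simp
  have d: "matrix_pderiv m (curv G a b) x = ?E m a b - ?E m b a
      + (?D m a ** ?A b + ?A a ** ?D m b - (?D m b ** ?A a + ?A b ** ?D m a))" for m a b
    unfolding curv_eq
    by (simp add: matrix_pderiv_add[OF _ _ x] matrix_pderiv_diff[OF _ _ x] matrix_pderiv_mult[OF _ _ x]
        smooth_matrix_on_diff smooth_matrix_on_mult smooth_matrix_on_pderiv smooth_conn open_U)
  have E: "?E i j k = ?E j i k" for i j k
    by (rule matrix_pderiv_commute[OF open_U smooth_conn x])
  show ?thesis
    unfolding cov_curv_def unfolding T2 T_def[symmetric] unfolding d unfolding curv_eq
    by (simp add: matrix_ring_simps E[of m a] E[of m b] E[of a b] T1[of m a] T1[of m b] T1[of a b]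
        algebra_simps)
qed

lemma cov_curv_swap:
  assumes x: "x \<in> U"
  shows "cov_curv m b a x = - cov_curv m a b x"
proof -
  have "matrix_pderiv m (curv G b a) x = - matrix_pderiv m (curv G a b) x"
    using matrix_pderiv_cong[OF open_U x, of "curv G b a" "\<lambda>y. - curv G a b y" m, OF curv_swap]
    by (simp add: matrix_pderiv_minus[OF smooth_curv x])
  moreover have "(\<Sum>p\<in>UNIV. c p *\<^sub>R curv G b p x) = - (\<Sum>p\<in>UNIV. c p *\<^sub>R curv G p b x)" for b and c :: "'n \<Rightarrow> real"
    unfolding sum_negf[symmetric] by (subst curv_swap) simp
  ultimately show ?thesis
    by (simp add: cov_curv_def curv_swap[of _ b a] matrix_ring_simps)
qed

text \<open>The skew-symmetry of R P holds on all of U and can be differentiated; since P is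
  parallel, the derivative falls on R alone. The corrections for the form indices are linear
  combinations of curvature matrices, hence skew after multiplication by P.\<close>

lemma cov_curv_P_antisym:
  assumes x: "x \<in> U"
  shows "cov_curv m a b x ** P x + transpose (cov_curv m a b x ** P x) = 0"
proof -
  let ?A = "conn G m x" and ?R = "curv G a b x"
  have anti: "transpose (curv G a b x ** P x) = - (curv G a b x ** P x)" for a b
    using curv_P_antisym[OF x] by (simp add: eq_neg_iff_add_eq_0 add.commute)
  have "matrix_pderiv m (\<lambda>y. curv G a b y ** P y + transpose (curv G a b y ** P y)) x
      = matrix_pderiv m (\<lambda>y. 0) x"
    by (rule matrix_pderiv_cong[OF open_U x]) (rule curv_P_antisym)
  then have d: "matrix_pderiv m (curv G a b) x ** P x + ?R ** matrix_pderiv m P x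
      + transpose (matrix_pderiv m (curv G a b) x ** P x + ?R ** matrix_pderiv m P x) = 0"
    by (simp add: matrix_pderiv_add[OF _ _ x] matrix_pderiv_transpose matrix_pderiv_mult[OF _ _ x]
        smooth_matrix_on_mult smooth_matrix_on_transpose smooth_curv smooth_P open_U)
  let ?Q = "?R ** P x"
  have "?R ** matrix_pderiv m P x = - (?R ** ?A ** P x) - ?Q ** transpose ?A"
    by (simp add: matrix_pderiv_P[OF x] matrix_ring_simps)
  \<comment> \<open>Both summands on the right are skew: the first is the derivative of the skew
    matrix Q = R P, the second is the action of \<open>A_m\<close> on Q as a bivector.\<close>
  then have "(matrix_pderiv m (curv G a b) x + ?A ** ?R - ?R ** ?A) ** P x =
      matrix_pderiv m (curv G a b) x ** P x + ?R ** matrix_pderiv m P x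
        + (?A ** ?Q + ?Q ** transpose ?A)"
    by (simp add: matrix_ring_simps)
  moreover have "transpose (?A ** ?Q + ?Q ** transpose ?A) = - (?A ** ?Q + ?Q ** transpose ?A)"
    by (simp add: transpose_add matrix_transpose_mul[of ?A] matrix_transpose_mul[of ?Q] anti
        matrix_ring_simps(5,6))
  moreover have "transpose (matrix_pderiv m (curv G a b) x ** P x + ?R ** matrix_pderiv m P x)
      = - (matrix_pderiv m (curv G a b) x ** P x + ?R ** matrix_pderiv m P x)"
    using d unfolding add_eq_0_iff .
  ultimately have "transpose ((matrix_pderiv m (curv G a b) x + ?A ** ?R - ?R ** ?A) ** P x)
      = - ((matrix_pderiv m (curv G a b) x + ?A ** ?R - ?R ** ?A) ** P x)"
    by (simp only: transpose_add minus_add_distrib)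
  then have main: "(matrix_pderiv m (curv G a b) x + ?A ** ?R - ?R ** ?A) ** P x
      + transpose ((matrix_pderiv m (curv G a b) x + ?A ** ?R - ?R ** ?A) ** P x) = 0"
    by simp
  have sums: "(\<Sum>p\<in>UNIV. c p *\<^sub>R curv G (f p) (h p) x) ** P x
      + transpose ((\<Sum>p\<in>UNIV. c p *\<^sub>R curv G (f p) (h p) x) ** P x) = 0"
    for c :: "'n \<Rightarrow> real" and f h
  proof -
    have "(\<Sum>p\<in>I. c p *\<^sub>R curv G (f p) (h p) x) ** P x
      + transpose ((\<Sum>p\<in>I. c p *\<^sub>R curv G (f p) (h p) x) ** P x) = 0" for I
    proof (induction I rule: infinite_finite_induct)
      case (insert q I)
      have "(c q *\<^sub>R curv G (f q) (h q) x) ** P x = c q *\<^sub>R (curv G (f q) (h q) x ** P x)"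
        by (simp add: scalar_matrix_assoc)
      then show ?case using insert
        by (simp add: matrix_add_rdistrib transpose_add transpose_scalar anti algebra_simps)
    qed (simp_all add: transpose_def vec_eq_iff)
    then show ?thesis .
  qed
  show ?thesis
    using main sums[of "\<lambda>p. conn G m x $ p $ a" "\<lambda>p. p" "\<lambda>p. b"]
      sums[of "\<lambda>p. conn G m x $ p $ b" "\<lambda>p. a" "\<lambda>p. p"]
    unfolding cov_curv_def
    by (simp only: matrix_diff_rdistrib transpose_diff) (simp add: algebra_simps)
qed

text \<open>The covariant derivative of Ric as a bilinear form; both indices are lower, hence the
  transpose and the two minus signs.\<close>

definition cov_ricci :: "'n \<Rightarrow> real^'n \<Rightarrow> real^'n^'n" where
  "cov_ricci m x = matrix_pderiv m (ricci_form G) x - transpose (conn G m x) ** ricci_form G x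
     - ricci_form G x ** conn G m x"

text \<open>Contraction commutes with covariant differentiation: the term A R and the correction for
  the first form index carry the two contracted indices and cancel in the trace.\<close>

lemma cov_ricci_nth:
  assumes x: "x \<in> U"
  shows "cov_ricci m x $ j $ k = (\<Sum>a\<in>UNIV. cov_curv m a j x $ a $ k)"
proof -
  let ?A = "conn G m x"
  have 1: "matrix_pderiv m (ricci_form G) x $ j $ k = (\<Sum>a\<in>UNIV. matrix_pderiv m (curv G a j) x $ a $ k)"
    by (simp add: matrix_pderiv_def ricci_form_eq pderiv_at_sum smooth_matrix_onD[OF smooth_curv x])
  have 2: "(\<Sum>a\<in>UNIV. (?A ** curv G a j x) $ a $ k) =
      (\<Sum>a\<in>UNIV. \<Sum>p\<in>UNIV. ?A $ p $ a * curv G p j x $ a $ k)"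
    unfolding matrix_mult_nth by (subst sum.swap) simp
  have 3: "(\<Sum>a\<in>UNIV. (curv G a j x ** ?A) $ a $ k) = (ricci_form G x ** ?A) $ j $ k"
    unfolding matrix_mult_nth ricci_form_eq sum_distrib_right by (subst sum.swap) simp
  have 4: "(\<Sum>a\<in>UNIV. \<Sum>p\<in>UNIV. ?A $ p $ j * curv G a p x $ a $ k) = (transpose ?A ** ricci_form G x) $ j $ k"
    unfolding matrix_mult_nth ricci_form_eq sum_distrib_left by (subst sum.swap) (simp add: transpose_def)
  show ?thesis
    unfolding cov_ricci_def cov_curv_def
    by (simp add: sum.distrib sum_subtractf 1 2 3 4)
qed

text \<open>After tracing the second Bianchi identity twice, the skew-symmetry of \<open>(\<nabla>R) P\<close> makes two of the three
  terms equal.\<close>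

lemma contracted_bianchi:
  assumes x: "x \<in> U"
  shows "pderiv_at m (scal G) x = 2 * (\<Sum>j\<in>UNIV. \<Sum>k\<in>UNIV. P x $ j $ k * cov_ricci j x $ m $ k)"
proof -
  let ?A = "conn G m x" and ?Rc = "ricci_form G x" and ?W = "\<lambda>m. cov_ricci m x" and ?N = "\<lambda>m a b. cov_curv m a b x"
  have "pderiv_at m (scal G) x = trace (matrix_pderiv m (\<lambda>y. P y ** ricci_form G y) x)"
    using smooth_matrix_onD[OF smooth_matrix_on_mult[OF open_U smooth_P smooth_ricci_form] x]
    by (simp add: scal_eq[abs_def] trace_def matrix_pderiv_def pderiv_at_sum)
  also have "matrix_pderiv m (\<lambda>y. P y ** ricci_form G y) x =
      P x ** ?W m + (P x ** ?Rc) ** ?A - ?A ** (P x ** ?Rc)"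
    by (simp add: matrix_pderiv_mult[OF smooth_P smooth_ricci_form x] matrix_pderiv_P[OF x] cov_ricci_def
        matrix_ring_simps)
  \<comment> \<open>The two remaining products form a commutator, which has trace zero.\<close>
  also have "trace \<dots> = trace (P x ** ?W m)"
    by (simp add: trace_add trace_sub trace_mul_sym[of "P x ** ?Rc"])
  also have "\<dots> = (\<Sum>k\<in>UNIV. \<Sum>j\<in>UNIV. \<Sum>a\<in>UNIV. P x $ k $ j * ?N m a j $ a $ k)"
    by (simp add: trace_def matrix_mult_nth cov_ricci_nth[OF x] sum_distrib_left)
  also have "\<dots> = (\<Sum>k\<in>UNIV. \<Sum>j\<in>UNIV. \<Sum>a\<in>UNIV. P x $ k $ j * ?N j a m $ a $ k)
      - (\<Sum>k\<in>UNIV. \<Sum>j\<in>UNIV. \<Sum>a\<in>UNIV. P x $ k $ j * ?N a j m $ a $ k)"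
  proof -
    \<comment> \<open>The second Bianchi identity solved for the derivative in direction m, so that
      only derivatives in the contracted directions j and a are left.\<close>
    have "?N m a j = ?N j a m - ?N a j m" for a j
      using second_bianchi[OF x, of m a j] cov_curv_swap[OF x, of j m a]
      by (simp add: algebra_simps eq_neg_iff_add_eq_0)
    then show ?thesis by (simp add: right_diff_distrib sum_subtractf)
  qed
  also have "(\<Sum>k\<in>UNIV. \<Sum>j\<in>UNIV. \<Sum>a\<in>UNIV. P x $ k $ j * ?N j a m $ a $ k) =
      (\<Sum>j\<in>UNIV. \<Sum>k\<in>UNIV. P x $ j $ k * ?W j $ m $ k)"
    by (subst sum.swap) (simp add: cov_ricci_nth[OF x] sum_distrib_left sym_P_nth[OF x])
  also have "(\<Sum>k\<in>UNIV. \<Sum>j\<in>UNIV. \<Sum>a\<in>UNIV. P x $ k $ j * ?N a j m $ a $ k) =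
      (\<Sum>j\<in>UNIV. \<Sum>a\<in>UNIV. (?N a j m ** P x) $ a $ j)"
    by (subst sum.swap, rule sum.cong[OF refl], subst sum.swap) (simp add: matrix_mult_nth mult.commute)
  also have "\<dots> = - (\<Sum>j\<in>UNIV. \<Sum>a\<in>UNIV. (?N a j m ** P x) $ j $ a)"
  proof -
    have "(?N a j m ** P x) $ a $ j = - (?N a j m ** P x) $ j $ a" for a j
      using arg_cong[OF cov_curv_P_antisym[OF x, of a j m], of "\<lambda>M. M $ a $ j"]
      by (simp add: transpose_def)
    then show ?thesis by (simp add: sum_negf)
  qed
  also have "(\<Sum>j\<in>UNIV. \<Sum>a\<in>UNIV. (?N a j m ** P x) $ j $ a) = (\<Sum>a\<in>UNIV. \<Sum>k\<in>UNIV. P x $ a $ k * ?W a $ m $ k)"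
    by (subst sum.swap, rule sum.cong[OF refl])
      (simp add: matrix_mult_nth cov_ricci_nth[OF x] sum_distrib_left, subst sum.swap,
        simp add: sym_P_nth[OF x] mult.commute)
  finally show ?thesis by simp
qed

end


section \<open>Local isometries\<close>

lemma matrix_mult_sum_scaleR_left:
  "(\<Sum>b\<in>I. c b *\<^sub>R M b) ** N = (\<Sum>b\<in>I. c b *\<^sub>R (M b ** N))"
  for M :: "'i \<Rightarrow> real^'n^'m" and N :: "real^'p^'n"
  by (induction I rule: infinite_finite_induct) (simp_all add: matrix_add_rdistrib scalar_matrix_assoc[symmetric])

lemma matrix_mult_sum_scaleR_right:
  "N ** (\<Sum>b\<in>I. c b *\<^sub>R M b) = (\<Sum>b\<in>I. c b *\<^sub>R (N ** M b))"
  for M :: "'i \<Rightarrow> real^'n^'m" and N :: "real^'m^'p"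
  by (induction I rule: infinite_finite_induct) (simp_all add: matrix_add_ldistrib matrix_scalar_ac scalar_matrix_assoc[symmetric])

lemma transpose_sum_scaleR:
  "transpose (\<Sum>b\<in>I. c b *\<^sub>R M b) = (\<Sum>b\<in>I. c b *\<^sub>R transpose (M b))" for M :: "'i \<Rightarrow> real^'n^'m"
  by (simp add: transpose_def vec_eq_iff)

text \<open>Source and target have the same dimension, so J is square and the isometry condition
  forces it to be invertible (\<open>det_J\<close>).\<close>

locale local_isometry = dom: local_metric U G + cod: local_metric V H
  for U :: "(real^'n::finite) set" and G and V :: "(real^'n) set" and H +
  fixes F :: "real^'n \<Rightarrow> real^'n"
  assumes smooth_F: "smooth_on F U" and F_in: "x \<in> U \<Longrightarrow> F x \<in> V"
    and isometric: "x \<in> U \<Longrightarrow> G x = transpose (jacobian F x) ** H (F x) ** jacobian F x"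
begin

abbreviation J :: "real^'n \<Rightarrow> real^'n^'n" where "J \<equiv> jacobian F"

text \<open>The connection of \<open>F\<^sup>*TV\<close>.\<close>

definition pull_conn :: "'n \<Rightarrow> real^'n \<Rightarrow> real^'n^'n" where
  "pull_conn i x = (\<Sum>b\<in>UNIV. J x $ b $ i *\<^sub>R conn H b (F x))"

lemma F_differentiable: "x \<in> U \<Longrightarrow> F differentiable (at x)"
  using smooth_F by (rule smooth_on_imp_differentiable)

lemma J_nth: "x \<in> U \<Longrightarrow> J x $ a $ i = pderiv_at i (\<lambda>y. F y $ a) x"
  by (intro jacobian_nth F_differentiable)

lemma smooth_J: "smooth_matrix_on J U"
  unfolding smooth_matrix_on_def
proof (intro allI)
  fix a i
  have "smooth_on (pderiv_at i (\<lambda>y. F y $ a)) U"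
    by (intro smooth_on_pderiv_at smooth_on_vec_nth smooth_F dom.open_U)
  then show "smooth_on (\<lambda>x. J x $ a $ i) U"
    by (rule smooth_on_cong[OF dom.open_U]) (rule J_nth)
qed

lemma det_J: "x \<in> U \<Longrightarrow> det (J x) \<noteq> 0"
  using dom.det_G[of x] isometric[of x] by (auto simp: det_mul)

lemma smooth_compose: "smooth_matrix_on M V \<Longrightarrow> smooth_matrix_on (\<lambda>x. M (F x)) U"
  using F_in by (intro smooth_matrix_on_compose[OF dom.open_U cod.open_U smooth_F]) auto

lemma matrix_pderiv_compose:
  assumes "x \<in> U" "smooth_matrix_on M V"
  shows "matrix_pderiv i (\<lambda>y. M (F y)) x = (\<Sum>b\<in>UNIV. J x $ b $ i *\<^sub>R matrix_pderiv b M (F x))"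
  by (simp add: matrix_pderiv_def vec_eq_iff mult.commute
      pderiv_at_compose[OF F_differentiable[OF assms(1)] smooth_matrix_onD[OF assms(2) F_in[OF assms(1)]]])

lemma smooth_pull_conn: "smooth_matrix_on (pull_conn i) U"
  using smooth_matrix_on_nth[OF smooth_J] smooth_matrix_on_nth[OF smooth_compose[OF cod.smooth_conn]]
  unfolding pull_conn_def smooth_matrix_on_def
  by (auto intro!: smooth_on_sum smooth_on_mult dom.open_U)

text \<open>The Hessian of each component of F is symmetric. Together with
  \<open>pull_conn_J_sym\<close>, which expresses that the target connection is torsion-free, this
  supplies the symmetry required by \<open>levi_civita_unique\<close>.\<close>

lemma matrix_pderiv_J_sym:
  assumes x: "x \<in> U"
  shows "matrix_pderiv i J x $ a $ j = matrix_pderiv j J x $ a $ i"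
proof -
  have "matrix_pderiv i J x $ a $ j = pderiv_at i (pderiv_at j (\<lambda>y. F y $ a)) x" for i j
    unfolding matrix_pderiv_def by (simp, rule pderiv_at_cong[OF dom.open_U x]) (rule J_nth)
  then show ?thesis
    using pderiv_at_commute[OF dom.open_U smooth_on_vec_nth[OF dom.open_U smooth_F] x] by simp
qed

lemma pull_conn_J_sym:
  assumes x: "x \<in> U"
  shows "(pull_conn i x ** J x) $ a $ j = (pull_conn j x ** J x) $ a $ i"
proof -
  have "(pull_conn i x ** J x) $ a $ j =
      (\<Sum>c\<in>UNIV. \<Sum>b\<in>UNIV. J x $ b $ i * J x $ c $ j * conn H b (F x) $ a $ c)" for i j
    by (simp add: matrix_mult_nth pull_conn_def sum_distrib_right sum_distrib_left mult.assoc mult.commute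
        mult.left_commute)
  then show ?thesis
    by (simp only:) (subst sum.swap, simp add: cod.conn_sym[OF F_in[OF x], of _ a] mult.commute mult.left_commute)
qed

text \<open>By uniqueness of the Levi-Civita connection, the second fundamental form \<open>\<nabla>(TF)\<close> of \<open>F\<close> vanishes.\<close>

lemma J_conn:
  assumes x: "x \<in> U"
  shows "J x ** conn G i x = matrix_pderiv i J x + pull_conn i x ** J x"
proof -
  define K where "K = matrix_inv (J x)"
  define Z where "Z i = matrix_pderiv i J x + pull_conn i x ** J x" for i
  \<comment> \<open>The pull-back of the target connection, written in the coordinate frame of the
    source; it is the candidate to be identified with the Levi-Civita connection of G.\<close>
  define C where "C i = K ** Z i" for i
  have JC: "J x ** C i = Z i" for i
    by (simp add: C_def K_def matrix_mul_assoc matrix_inv_right det_J x)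
  have Zsym: "Z i $ a $ k = Z k $ a $ i" for i a k
    by (simp add: Z_def matrix_pderiv_J_sym[OF x, of i] pull_conn_J_sym[OF x, of i])
  have Csym: "C i $ l $ k = C k $ l $ i" for i l k
    unfolding C_def matrix_mult_nth by (subst Zsym) simp
  have HF: "matrix_pderiv i (\<lambda>y. H (F y)) x =
      transpose (pull_conn i x) ** H (F x) + H (F x) ** pull_conn i x" for i
    by (simp add: matrix_pderiv_compose[OF x cod.smooth_G] cod.metric_compatible[OF F_in[OF x]]
        pull_conn_def matrix_mult_sum_scaleR_left matrix_mult_sum_scaleR_right transpose_sum_scaleR
        scaleR_add_right sum.distrib)
  \<comment> \<open>Compatibility of C comes from differentiating the isometry equation: each
    derivative of J combines with a term from H into Z = J C.\<close>
  have "matrix_pderiv i G x = transpose (C i) ** G x + G x ** C i" for i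
  proof -
    have "matrix_pderiv i G x = matrix_pderiv i (\<lambda>y. transpose (J y) ** H (F y) ** J y) x"
      by (rule matrix_pderiv_cong[OF dom.open_U x]) (rule isometric)
    also have "\<dots> = transpose (Z i) ** H (F x) ** J x + transpose (J x) ** H (F x) ** Z i"
      by (simp add: matrix_pderiv_mult[OF _ _ x] smooth_matrix_on_mult smooth_matrix_on_transpose smooth_J
          smooth_compose cod.smooth_G dom.open_U matrix_pderiv_transpose HF Z_def matrix_ring_simps
          transpose_simps)
    also have "\<dots> = transpose (C i) ** (transpose (J x) ** H (F x) ** J x)
        + (transpose (J x) ** H (F x) ** J x) ** C i"
      unfolding JC[symmetric] by (simp add: matrix_transpose_mul matrix_mul_assoc)
    finally show ?thesis by (simp add: isometric[OF x])
  qed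
  then have "C i = conn G i x"
    using dom.levi_civita_unique[OF x Csym] by blast
  then show ?thesis using JC Z_def by metis
qed

text \<open>Differentiating \<open>J_conn\<close> once more and antisymmetrizing removes the second
  derivatives of J and shows that J intertwines the curvature of G with that of the pulled-back
  connection. The latter is then the pull-back of the curvature of H.\<close>

lemma J_curv:
  assumes x: "x \<in> U"
  shows "J x ** curv G m i x =
    (\<Sum>e\<in>UNIV. J x $ e $ m *\<^sub>R (\<Sum>b\<in>UNIV. J x $ b $ i *\<^sub>R (curv H e b (F x) ** J x)))"
proof -
  let ?A = "\<lambda>i. conn G i x" and ?B = "\<lambda>i. pull_conn i x" and ?J = "J x"
  let ?h = "\<lambda>b. conn H b (F x)" and ?dh = "\<lambda>e b. matrix_pderiv e (conn H b) (F x)"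
  \<comment> \<open>Evaluation of a family indexed by two target directions on the images of d_m and
    d_i; the antisymmetrization is carried out in this notation.\<close>
  define S where "S m i M = (\<Sum>e\<in>UNIV. \<Sum>b\<in>UNIV. (?J $ e $ m * ?J $ b $ i) *\<^sub>R (M e b :: real^'n^'n))" for m i M
  have S_swap: "S m i M = S i m (\<lambda>e b. M b e)" for m i M
    unfolding S_def by (subst sum.swap) (simp add: mult.commute)
  have dJ: "matrix_pderiv i J x = ?J ** ?A i - ?B i ** ?J" for i
    by (simp add: J_conn[OF x])
  have "matrix_pderiv m J x ** ?A i + ?J ** matrix_pderiv m (conn G i) x =
      matrix_pderiv m (matrix_pderiv i J) x + (matrix_pderiv m (pull_conn i) x ** ?J
        + ?B i ** matrix_pderiv m J x)" for m i
  proof -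
    have "matrix_pderiv m (\<lambda>y. J y ** conn G i y) x =
        matrix_pderiv m (\<lambda>y. matrix_pderiv i J y + pull_conn i y ** J y) x"
      by (rule matrix_pderiv_cong[OF dom.open_U x]) (rule J_conn)
    then show ?thesis
      by (simp add: matrix_pderiv_mult[OF _ _ x] matrix_pderiv_add[OF _ _ x] smooth_J dom.smooth_conn
          smooth_matrix_on_pderiv smooth_matrix_on_mult smooth_pull_conn dom.open_U)
  qed
  from this[of m i] this[of i m]
  have 1: "?J ** curv G m i x =
      (matrix_pderiv m (pull_conn i) x - matrix_pderiv i (pull_conn m) x + ?B m ** ?B i - ?B i ** ?B m) ** ?J"
    using matrix_pderiv_commute[OF dom.open_U smooth_J x, of m i]
    unfolding curv_eq dJ by (simp add: matrix_ring_simps algebra_simps)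
  \<comment> \<open>The first sum contains the Hessian of F; being symmetric in m and i, it drops
    out of the antisymmetrization.\<close>
  have dB: "matrix_pderiv m (pull_conn i) x =
      (\<Sum>b\<in>UNIV. matrix_pderiv m J x $ b $ i *\<^sub>R ?h b) + S m i (\<lambda>e b. ?dh e b)" for m i
  proof -
    have "matrix_pderiv m (pull_conn i) x =
        (\<Sum>b\<in>UNIV. matrix_pderiv m (\<lambda>y. J y $ b $ i *\<^sub>R conn H b (F y)) x)"
      using smooth_matrix_onD[OF smooth_matrix_on_scaleR[OF dom.open_U smooth_matrix_on_nth[OF smooth_J]
            smooth_compose[OF cod.smooth_conn]] x]
      by (simp add: matrix_pderiv_def pull_conn_def vec_eq_iff pderiv_at_sum)
    also have "\<dots> = (\<Sum>b\<in>UNIV. matrix_pderiv m J x $ b $ i *\<^sub>R ?h b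
        + J x $ b $ i *\<^sub>R (\<Sum>e\<in>UNIV. J x $ e $ m *\<^sub>R ?dh e b))"
      by (simp add: matrix_pderiv_scaleR[OF smooth_matrix_on_nth[OF smooth_J] smooth_compose[OF cod.smooth_conn] x]
          matrix_pderiv_compose[OF x cod.smooth_conn]) (simp add: matrix_pderiv_def)
    also have "\<dots> = (\<Sum>b\<in>UNIV. matrix_pderiv m J x $ b $ i *\<^sub>R ?h b) + S m i (\<lambda>e b. ?dh e b)"
      unfolding S_def
      by (subst sum.swap) (simp add: sum.distrib scaleR_sum_right mult.commute)
    finally show ?thesis .
  qed
  have BB: "?B m ** ?B i = S m i (\<lambda>e b. ?h e ** ?h b)" for m i
    by (simp add: pull_conn_def S_def matrix_mult_sum_scaleR_left matrix_mult_sum_scaleR_right scaleR_sum_right)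
      (subst sum.swap, simp add: mult.commute)
  have "matrix_pderiv m (pull_conn i) x - matrix_pderiv i (pull_conn m) x + ?B m ** ?B i - ?B i ** ?B m
      = S m i (\<lambda>e b. ?dh e b) - S m i (\<lambda>e b. ?dh b e)
        + S m i (\<lambda>e b. ?h e ** ?h b) - S m i (\<lambda>e b. ?h b ** ?h e)"
    unfolding dB BB S_swap[of i m] by (simp add: matrix_pderiv_J_sym[OF x, of m _ i])
  also have "\<dots> = S m i (\<lambda>e b. curv H e b (F x))"
    by (simp add: S_def curv_eq sum.distrib sum_subtractf scaleR_add_right scaleR_diff_right)
  finally show ?thesis
    unfolding 1 S_def
    by (simp add: matrix_mult_sum_scaleR_left scaleR_sum_right[symmetric] scaleR_scaleR[symmetric] del: scaleR_scaleR)
qed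

text \<open>By \<open>J_curv\<close> the endomorphism whose trace defines Ric is conjugated by J;
  the trace does not see this, and only the two arguments of the form are transformed.\<close>

lemma ricci_form_isometric:
  assumes x: "x \<in> U"
  shows "ricci_form G x = transpose (J x) ** ricci_form H (F x) ** J x"
proof -
  let ?J = "J x"
  define K where "K = matrix_inv ?J"
  have JK: "?J ** K = mat 1" and KJ: "K ** ?J = mat 1"
    by (simp_all add: K_def matrix_inv_left matrix_inv_right det_J x)
  \<comment> \<open>The factor J on the contracted lower index meets the factor K on the contracted
    upper index, and J K = 1.\<close>
  have contract: "(\<Sum>m\<in>UNIV. (K ** (\<Sum>e\<in>UNIV. ?J $ e $ m *\<^sub>R Y e)) $ m $ k) = (\<Sum>e\<in>UNIV. Y e $ e $ k)"
    for Y :: "'n \<Rightarrow> real^'n^'n" and k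
  proof -
    have "(\<Sum>m\<in>UNIV. (K ** (\<Sum>e\<in>UNIV. ?J $ e $ m *\<^sub>R Y e)) $ m $ k) =
        (\<Sum>m\<in>UNIV. \<Sum>e\<in>UNIV. \<Sum>a\<in>UNIV. ?J $ e $ m * K $ m $ a * Y e $ a $ k)"
      unfolding matrix_mult_sum_scaleR_right
      by (simp add: matrix_mult_nth sum_distrib_left mult.assoc)
    also have "\<dots> = (\<Sum>e\<in>UNIV. \<Sum>a\<in>UNIV. \<Sum>m\<in>UNIV. ?J $ e $ m * K $ m $ a * Y e $ a $ k)"
      by (subst sum.swap, rule sum.cong[OF refl], rule sum.swap)
    also have "\<dots> = (\<Sum>e\<in>UNIV. \<Sum>a\<in>UNIV. (?J ** K) $ e $ a * Y e $ a $ k)"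
      by (simp add: matrix_mult_nth sum_distrib_right)
    also have "\<dots> = (\<Sum>e\<in>UNIV. Y e $ e $ k)"
      by (simp add: JK mat_def if_distrib[of "\<lambda>z. z * _"] cong: if_cong)
    finally show ?thesis .
  qed
  have "ricci_form G x $ i $ k = (transpose ?J ** ricci_form H (F x) ** ?J) $ i $ k" for i k
  proof -
    have "curv G m i x = K ** (?J ** curv G m i x)" for m
      by (simp add: matrix_mul_assoc KJ)
    then have "ricci_form G x $ i $ k = (\<Sum>m\<in>UNIV. (K ** (?J ** curv G m i x)) $ m $ k)"
      by (simp add: ricci_form_eq)
    also have "\<dots> = (\<Sum>e\<in>UNIV. (\<Sum>b\<in>UNIV. ?J $ b $ i *\<^sub>R (curv H e b (F x) ** ?J)) $ e $ k)"
      unfolding J_curv[OF x] by (rule contract)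
    also have "\<dots> = (\<Sum>b\<in>UNIV. ?J $ b $ i * (\<Sum>c\<in>UNIV. \<Sum>e\<in>UNIV. curv H e b (F x) $ e $ c * ?J $ c $ k))"
      by (simp add: matrix_mult_nth, subst sum.swap, simp add: sum_distrib_left,
          rule sum.cong[OF refl], rule sum.swap)
    also have "\<dots> = (transpose ?J ** (ricci_form H (F x) ** ?J)) $ i $ k"
      by (simp add: matrix_mult_nth transpose_def ricci_form_eq sum_distrib_right)
    finally show ?thesis by (simp add: matrix_mul_assoc)
  qed
  then show ?thesis by (simp add: vec_eq_iff)
qed

lemma scal_isometric:
  assumes x: "x \<in> U"
  shows "scal G x = scal H (F x)"
proof -
  let ?M = "dom.P x ** transpose (J x)"
  have "?M ** H (F x) ** J x = mat 1"
    using dom.P_G[OF x] isometric[OF x] by (simp add: matrix_mul_assoc)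
  \<comment> \<open>The preceding equation is P G = 1 with the isometry condition inserted. A
    one-sided inverse of a square matrix is two-sided, so the factors may be rotated; this shows
    that the inverse metric is pushed forward by J.\<close>
  then have "J x ** (?M ** H (F x)) = mat 1"
    using matrix_left_right_inverse by blast
  then have "J x ** ?M ** (H (F x) ** cod.P (F x)) = cod.P (F x)"
    by (simp add: matrix_mul_assoc)
  then have JM: "J x ** ?M = cod.P (F x)"
    by (simp add: cod.G_P[OF F_in[OF x]])
  have "scal G x = trace ((?M ** ricci_form H (F x)) ** J x)"
    by (simp add: scal_eq ricci_form_isometric[OF x] matrix_mul_assoc)
  also have "\<dots> = trace (J x ** ?M ** ricci_form H (F x))"
    by (subst trace_mul_sym) (simp add: matrix_mul_assoc)
  finally show ?thesis by (simp add: JM scal_eq)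
qed

end


section \<open>The C-harmonic operator of a local isometry\<close>

text \<open>Moves a fixed matrix factor out of the metric trace in the codifferential; applied once
  to J and once to the inverse metric.\<close>

lemma sum_pull_out:
  fixes p :: "'i::finite \<Rightarrow> 'j::finite \<Rightarrow> real" and a :: "'k::finite \<Rightarrow> real"
  shows "(\<Sum>i\<in>UNIV. \<Sum>j\<in>UNIV. p i j * (\<Sum>m\<in>UNIV. a m * X i m j)) =
    (\<Sum>m\<in>UNIV. a m * (\<Sum>i\<in>UNIV. \<Sum>j\<in>UNIV. p i j * X i m j))"
proof -
  have "(\<Sum>i\<in>UNIV. \<Sum>j\<in>UNIV. p i j * (\<Sum>m\<in>UNIV. a m * X i m j)) =
      (\<Sum>i\<in>UNIV. \<Sum>j\<in>UNIV. \<Sum>m\<in>UNIV. a m * (p i j * X i m j))"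
    by (simp add: sum_distrib_left mult.left_commute)
  also have "\<dots> = (\<Sum>i\<in>UNIV. \<Sum>m\<in>UNIV. \<Sum>j\<in>UNIV. a m * (p i j * X i m j))"
    by (rule sum.cong[OF refl]) (rule sum.swap)
  also have "\<dots> = (\<Sum>m\<in>UNIV. \<Sum>i\<in>UNIV. \<Sum>j\<in>UNIV. a m * (p i j * X i m j))"
    by (rule sum.swap)
  finally show ?thesis by (simp add: sum_distrib_left)
qed

context local_isometry
begin

section \<open>Covariant derivatives and codifferentials along a local isometry\<close>

lemma nabla_form_eq:
  assumes x: "x \<in> U"
  shows "nabla_form G H F \<omega> x j a i =
    (matrix_pderiv j \<omega> x + pull_conn j x ** \<omega> x - \<omega> x ** conn G j x) $ a $ i"
proof -
  have "(\<Sum>b\<in>UNIV. \<Sum>c\<in>UNIV. christoffel H (F x) a b c * pderiv_at j (\<lambda>y. F y $ b) x * \<omega> x $ c $ i)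
      = (pull_conn j x ** \<omega> x) $ a $ i"
    by (subst sum.swap)
      (simp add: matrix_mult_nth pull_conn_def conn_def J_nth[OF x] sum_distrib_right sum_distrib_left
        mult_ac)
  then show ?thesis
    by (simp add: nabla_form_def matrix_pderiv_def matrix_mult_nth conn_def mult.commute)
qed

text \<open>The Leibniz rule with TF parallel: the derivative falls on the endomorphism E alone. The
  case E = Id gives \<open>codiff_J\<close>.\<close>

lemma nabla_form_J_mult:
  assumes x: "x \<in> U" and E: "smooth_matrix_on E U"
  shows "nabla_form G H F (\<lambda>y. J y ** E y) x j a i =
    (J x ** (matrix_pderiv j E x + conn G j x ** E x - E x ** conn G j x)) $ a $ i"
proof -
  have "matrix_pderiv j (\<lambda>y. J y ** E y) x + pull_conn j x ** (J x ** E x) =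
      (matrix_pderiv j J x + pull_conn j x ** J x) ** E x + J x ** matrix_pderiv j E x"
    by (simp add: matrix_pderiv_mult[OF smooth_J E x] matrix_ring_simps)
  then show ?thesis
    unfolding nabla_form_eq[OF x] J_conn[OF x, symmetric] by (simp add: matrix_ring_simps)
qed

lemma codiff_J: "x \<in> U \<Longrightarrow> codiff G H F J x = 0"
  using nabla_form_J_mult[OF _ smooth_matrix_on_const[of "mat 1"]] by (simp add: codiff_def vec_eq_iff)

text \<open>The form has to vanish on the whole open set, not just at x, because it gets
  differentiated. With \<open>cov_d_zero\<close> this carries the zero of \<open>codiff_J\<close>
  through the two outer operators.\<close>

lemma codiff_zero:
  assumes "\<And>y. y \<in> U \<Longrightarrow> \<omega> y = 0" "x \<in> U"
  shows "codiff G H F \<omega> x = 0"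
proof -
  have "matrix_pderiv j \<omega> x = matrix_pderiv j (\<lambda>y. 0) x" for j
    by (rule matrix_pderiv_cong[OF dom.open_U assms(2)]) (rule assms(1))
  then show ?thesis
    by (simp add: codiff_def vec_eq_iff nabla_form_eq[OF assms(2)] assms)
qed

lemma cov_d_zero:
  assumes "\<And>y. y \<in> U \<Longrightarrow> \<xi> y = 0" "x \<in> U"
  shows "cov_d H F \<xi> x = 0"
proof -
  have "pderiv_at i (\<lambda>y. \<xi> y $ a) x = pderiv_at i (\<lambda>y. 0) x" for i a
    by (rule pderiv_at_cong[OF dom.open_U assms(2)]) (simp add: assms(1))
  then show ?thesis by (simp add: cov_d_def vec_eq_iff assms)
qed

definition scal_gradient :: "real^'n \<Rightarrow> real^'n" where
  "scal_gradient x = dom.P x *v (\<chi> i. pderiv_at i (scal G) x)"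

lemma codiff_einstein:
  assumes x: "x \<in> U"
  shows "codiff G H F (\<lambda>y. (2/3 * scal G y) *\<^sub>R J y - 2 *\<^sub>R (J y ** ricci_endo G y)) x =
    (1/3) *\<^sub>R (J x *v scal_gradient x)"
proof -
  let ?P = "dom.P x" and ?dS = "\<lambda>i. pderiv_at i (scal G) x" and ?W = "\<lambda>i. dom.cov_ricci i x"
  define s where "s y = 2/3 * scal G y" for y
  define E where "E y = s y *\<^sub>R mat 1 - 2 *\<^sub>R ricci_endo G y" for y
  define X where "X i = (2/3 * ?dS i) *\<^sub>R mat 1 - 2 *\<^sub>R (?P ** ?W i)" for i
  have sm: "smooth_on s U" "smooth_on (\<lambda>y. 2 :: real) U"
    unfolding s_def[abs_def] by (intro smooth_on_mult smooth_on_const dom.smooth_scal dom.open_U)+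
  have E_smooth: "smooth_matrix_on E U"
    unfolding E_def
    by (intro smooth_matrix_on_diff smooth_matrix_on_scaleR smooth_matrix_on_const sm
        dom.smooth_ricci_endo dom.open_U)
  have JE: "(\<lambda>y. (2/3 * scal G y) *\<^sub>R J y - 2 *\<^sub>R (J y ** ricci_endo G y)) = (\<lambda>y. J y ** E y)"
    by (simp add: E_def s_def fun_eq_iff matrix_diff_ldistrib matrix_scalar_ac scalar_matrix_assoc[symmetric])
  have cov: "matrix_pderiv i E x + conn G i x ** E x - E x ** conn G i x = X i" for i
  proof -
    have "pderiv_at i s x = 2/3 * ?dS i"
      unfolding s_def[abs_def]
      using pderiv_at_mult[OF _ smooth_on_imp_differentiable[OF dom.smooth_scal x], of "\<lambda>y. 2/3"] by simp
    then have dE: "matrix_pderiv i E x = (2/3 * ?dS i) *\<^sub>R mat 1 - 2 *\<^sub>R matrix_pderiv i (ricci_endo G) x"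
      unfolding E_def
      by (simp add: matrix_pderiv_diff[OF _ _ x] matrix_pderiv_scaleR[OF _ _ x] sm smooth_matrix_on_scaleR
          smooth_matrix_on_const dom.smooth_ricci_endo dom.open_U)
    \<comment> \<open>Raising an index commutes with the covariant derivative, since P is
      parallel.\<close>
    have dR: "matrix_pderiv i (ricci_endo G) x + conn G i x ** ricci_endo G x - ricci_endo G x ** conn G i x
        = ?P ** ?W i"
      unfolding ricci_endo_def
      by (simp add: matrix_pderiv_mult[OF dom.smooth_P dom.smooth_ricci_form x] dom.matrix_pderiv_P[OF x]
          dom.cov_ricci_def matrix_ring_simps)
    have "conn G i x ** E x - E x ** conn G i x =
        - 2 *\<^sub>R (conn G i x ** ricci_endo G x - ricci_endo G x ** conn G i x)"
      unfolding E_def matrix_diff_ldistrib matrix_diff_rdistrib matrix_scalar_ac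
      by (simp add: scalar_matrix_assoc[symmetric] scaleR_diff_right)
    then show ?thesis
      unfolding dE X_def dR[symmetric] by (simp add: scaleR_add_right scaleR_diff_right algebra_simps)
  qed
  have "(\<Sum>i\<in>UNIV. \<Sum>j\<in>UNIV. ?P $ i $ j * (J x ** X i) $ a $ j) = (\<Sum>m\<in>UNIV. J x $ a $ m *
      (\<Sum>i\<in>UNIV. \<Sum>j\<in>UNIV. ?P $ i $ j * X i $ m $ j))" for a
    unfolding matrix_mult_nth by (rule sum_pull_out)
  \<comment> \<open>The constant is 2/3 - 2 * 1/2: the contracted Bianchi identity makes the
    divergence of Ric half the gradient of Scal. The sign of \<open>codiff\<close> turns -1/3 into
    1/3.\<close>
  moreover have "(\<Sum>i\<in>UNIV. \<Sum>j\<in>UNIV. ?P $ i $ j * X i $ m $ j) = - (1/3) * scal_gradient x $ m" for m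
  proof -
    have "(\<Sum>i\<in>UNIV. \<Sum>j\<in>UNIV. ?P $ i $ j * (?P ** ?W i) $ m $ j) =
        (\<Sum>k\<in>UNIV. ?P $ m $ k * (\<Sum>i\<in>UNIV. \<Sum>j\<in>UNIV. ?P $ i $ j * ?W i $ k $ j))"
      unfolding matrix_mult_nth by (rule sum_pull_out)
    also have "\<dots> = scal_gradient x $ m / 2"
      unfolding scal_gradient_def matrix_vector_mult_def
      by (simp add: dom.contracted_bianchi[OF x] sum_divide_distrib)
    finally have 1: "(\<Sum>i\<in>UNIV. \<Sum>j\<in>UNIV. ?P $ i $ j * (?P ** ?W i) $ m $ j) = scal_gradient x $ m / 2" .
    have "(\<Sum>i\<in>UNIV. \<Sum>j\<in>UNIV. ?P $ i $ j * ((2/3 * ?dS i) *\<^sub>R mat 1) $ m $ j) =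
        2/3 * (\<Sum>i\<in>UNIV. ?P $ i $ m * ?dS i)"
      by (simp add: mat_def if_distrib sum_distrib_left mult.left_commute cong: if_cong)
    also have "(\<Sum>i\<in>UNIV. ?P $ i $ m * ?dS i) = scal_gradient x $ m"
      by (simp add: scal_gradient_def matrix_vector_mult_def dom.sym_P_nth[OF x, of _ m])
    finally have 2: "(\<Sum>i\<in>UNIV. \<Sum>j\<in>UNIV. ?P $ i $ j * ((2/3 * ?dS i) *\<^sub>R mat 1) $ m $ j) =
        2/3 * scal_gradient x $ m" .
    have "(\<Sum>i\<in>UNIV. \<Sum>j\<in>UNIV. ?P $ i $ j * X i $ m $ j) =
        (\<Sum>i\<in>UNIV. \<Sum>j\<in>UNIV. ?P $ i $ j * ((2/3 * ?dS i) *\<^sub>R mat 1) $ m $ j)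
        - 2 * (\<Sum>i\<in>UNIV. \<Sum>j\<in>UNIV. ?P $ i $ j * (?P ** ?W i) $ m $ j)"
      unfolding X_def
      by (simp only: vector_minus_component vector_scaleR_component[of 2] right_diff_distrib sum_subtractf
          sum_distrib_left) (simp add: mult.left_commute)
    then show ?thesis unfolding 1 2 by simp
  qed
  ultimately show ?thesis
    unfolding JE codiff_def nabla_form_J_mult[OF x E_smooth] cov
    by (simp add: vec_eq_iff matrix_vector_mult_def sum_distrib_left sum_negf)
qed

lemma scal_gradient_eq_0_iff:
  assumes x: "x \<in> U"
  shows "J x *v scal_gradient x = 0 \<longleftrightarrow> (\<forall>i. pderiv_at i (scal G) x = 0)"
proof
  assume "J x *v scal_gradient x = 0"
  then have "dom.P x *v (\<chi> i. pderiv_at i (scal G) x) = 0"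
    by (metis scal_gradient_def det_J[OF x] matrix_inv_left matrix_vector_mul_assoc matrix_vector_mul_lid
        matrix_vector_mult_0_right)
  then have "(\<chi> i. pderiv_at i (scal G) x) = 0"
    by (metis dom.G_P[OF x] matrix_vector_mul_assoc matrix_vector_mul_lid matrix_vector_mult_0_right)
  then show "\<forall>i. pderiv_at i (scal G) x = 0" by (simp add: vec_eq_iff)
next
  assume "\<forall>i. pderiv_at i (scal G) x = 0"
  then have "(\<chi> i. pderiv_at i (scal G) x) = 0" by (simp add: vec_eq_iff)
  then show "J x *v scal_gradient x = 0" by (simp add: scal_gradient_def)
qed

end

lemma C_operator_isometry:
  fixes U :: "(real^4) set"
  assumes "local_isometry U G V H F" and x: "x \<in> U"
  shows "C_operator G H F x = 0 \<longleftrightarrow> (\<forall>i. pderiv_at i (scal G) x = 0)"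
proof -
  interpret local_isometry U G V H F by fact
  have "codiff G H F (cov_d H F (codiff G H F J)) x = 0"
    by (intro codiff_zero cov_d_zero codiff_J x)
  \<comment> \<open>Whichever frame the choice operator returns, the curvature is evaluated on a
    zero first argument.\<close>
  moreover have "S_op G H F (codiff G H F J) x = 0"
    by (simp add: S_op_def Let_def codiff_J[OF x] curvature_op_def vec_eq_iff)
  ultimately have "C_operator G H F x = (1/3) *\<^sub>R (J x *v scal_gradient x)"
    by (simp only: C_operator_def Let_def codiff_einstein[OF x] add_0 diff_zero)
  then show ?thesis by (simp add: scal_gradient_eq_0_iff[OF x])
qed


section \<open>Passing to the manifold\<close>

context
  fixes A :: "('m::{t2_space, second_countable_topology}, 'n::finite) chart set" and g :: "('m, 'n) metric"
  assumes M: "riemannian_manifold A g"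
begin

lemma chart_facts:
  assumes "c \<in> A"
  shows "open (chart_dom c)" "open (coord c ` chart_dom c)" "continuous_on (chart_dom c) (coord c)"
    "p \<in> chart_dom c \<Longrightarrow> coord_inv c (coord c p) = p"
    "continuous_on (coord c ` chart_dom c) (coord_inv c)"
  using M assms
  by (auto simp: riemannian_manifold_def smooth_atlas_def is_chart_def homeomorphism_def)

lemma open_coord_image:
  assumes "c \<in> A" "open W" "W \<subseteq> chart_dom c"
  shows "open (coord c ` W)"
proof -
  have "coord c ` W = coord c ` chart_dom c \<inter> coord_inv c -` W"
    using chart_facts(4)[OF assms(1)] assms(3) by force
  then show ?thesis
    using continuous_open_preimage[OF chart_facts(5)[OF assms(1)] chart_facts(2)[OF assms(1)] assms(2)] by simp
qed

lemma local_metric_chart: "c \<in> A \<Longrightarrow> local_metric (coord c ` chart_dom c) (g c)"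
  using M by unfold_locales
    (auto simp: riemannian_manifold_def riemannian_metric_def chart_facts intro: smooth_matrix_on_smooth_on)

text \<open>The isometry condition is the transformation law of the Gram matrices contained in
  \<open>riemannian_metric\<close>.\<close>

lemma local_isometry_transition:
  assumes c: "c \<in> A" and d: "d \<in> A"
  shows "local_isometry (coord c ` (chart_dom c \<inter> chart_dom d)) (g c) (coord d ` chart_dom d) (g d)
    (local_rep c d id)"
proof -
  interpret c: local_metric "coord c ` chart_dom c" "g c" using c by (rule local_metric_chart)
  interpret d: local_metric "coord d ` chart_dom d" "g d" using d by (rule local_metric_chart)
  have F: "local_rep c d id = coord d \<circ> coord_inv c"
    by (simp add: local_rep_def)
  have op: "open (coord c ` (chart_dom c \<inter> chart_dom d))"
    by (intro open_coord_image open_Int chart_facts(1) c d) auto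
  show ?thesis
  proof
    show "open (coord c ` (chart_dom c \<inter> chart_dom d))" by fact
    show "smooth_matrix_on (g c) (coord c ` (chart_dom c \<inter> chart_dom d))"
      using c.smooth_G by (rule smooth_matrix_on_subset) blast
    show "smooth_on (local_rep c d id) (coord c ` (chart_dom c \<inter> chart_dom d))"
      using M c d by (simp add: F riemannian_manifold_def smooth_atlas_def)
    fix x assume x: "x \<in> coord c ` (chart_dom c \<inter> chart_dom d)"
    then have x': "x \<in> coord c ` chart_dom c" by blast
    show "transpose (g c x) = g c x" using x' by (rule c.sym_G)
    show "v \<bullet> (g c x *v v) > 0" if "v \<noteq> 0" for v using x' that by (rule c.pos_G)
    show "local_rep c d id x \<in> coord d ` chart_dom d"
      using x chart_facts(4)[OF c] by (auto simp: F)
    show "g c x = transpose (jacobian (local_rep c d id) x) ** g d (local_rep c d id x)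
        ** jacobian (local_rep c d id) x"
      using M c d x unfolding F riemannian_manifold_def riemannian_metric_def Let_def by blast
  qed
qed

text \<open>The chart chosen in \<open>scalar_curvature\<close> is related to c by a transition map,
  and \<open>scal_isometric\<close> makes the choice irrelevant.\<close>

lemma scalar_curvature_chart:
  assumes c: "c \<in> A" and p: "p \<in> chart_dom c"
  shows "scalar_curvature A g p = scal (g c) (coord c p)"
proof -
  define d where "d = (SOME d. d \<in> A \<and> p \<in> chart_dom d)"
  have "d \<in> A \<and> p \<in> chart_dom d"
    unfolding d_def by (rule someI[of _ c]) (use c p in simp)
  then have d: "d \<in> A" "p \<in> chart_dom d" by auto
  interpret local_isometry "coord d ` (chart_dom d \<inter> chart_dom c)" "g d" "coord c ` chart_dom c" "g c"
    "local_rep d c id"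
    using d(1) c by (rule local_isometry_transition)
  have "scal (g d) (coord d p) = scal (g c) (coord c p)"
    using scal_isometric[of "coord d p"] d p chart_facts(4)[OF d] by (auto simp: local_rep_def)
  then show ?thesis by (simp add: scalar_curvature_def Let_def d_def)
qed

lemma scalar_curvature_constant_iff:
  assumes "connected (UNIV :: 'm set)"
  shows "scalar_curvature A g constant_on UNIV \<longleftrightarrow>
    (\<forall>c\<in>A. \<forall>x\<in>coord c ` chart_dom c. \<forall>i. pderiv_at i (scal (g c)) x = 0)"
proof
  assume "scalar_curvature A g constant_on UNIV"
  then obtain k where k: "\<And>p. scalar_curvature A g p = k" by (auto simp: constant_on_def)
  show "\<forall>c\<in>A. \<forall>x\<in>coord c ` chart_dom c. \<forall>i. pderiv_at i (scal (g c)) x = 0"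
  proof (intro ballI allI)
    fix c x i assume c: "c \<in> A" and x: "x \<in> coord c ` chart_dom c"
    have "pderiv_at i (scal (g c)) x = pderiv_at i (\<lambda>y. k) x"
      by (rule pderiv_at_cong[OF chart_facts(2)[OF c] x]) (use scalar_curvature_chart[OF c] k in auto)
    then show "pderiv_at i (scal (g c)) x = 0" by simp
  qed
next
  assume crit: "\<forall>c\<in>A. \<forall>x\<in>coord c ` chart_dom c. \<forall>i. pderiv_at i (scal (g c)) x = 0"
  have loc: "\<forall>\<^sub>F q in at p. scalar_curvature A g p = scalar_curvature A g q" for p
  proof -
    obtain c where c: "c \<in> A" and p: "p \<in> chart_dom c"
      using M unfolding riemannian_manifold_def smooth_atlas_def by blast
    interpret local_metric "coord c ` chart_dom c" "g c" using c by (rule local_metric_chart)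
    have der: "(scal (g c) has_derivative (\<lambda>h. 0)) (at x)" if "x \<in> coord c ` chart_dom c" for x
    proof -
      let ?D = "frechet_derivative (scal (g c)) (at x)"
      have D: "(scal (g c) has_derivative ?D) (at x)"
        using smooth_on_imp_differentiable[OF smooth_scal that] by (simp add: frechet_derivative_works)
      have "pderiv_at i (scal (g c)) x = 0" for i
        using crit c that by blast
      then have "?D h = 0" for h
        by (simp add: frechet_derivative_eq_sum_pderiv_at smooth_on_imp_differentiable[OF smooth_scal that])
      then have "?D = (\<lambda>h. 0)" ..
      then show ?thesis using D by simp
    qed
    \<comment> \<open>A ball is used because vanishing of the derivative yields constancy only on a
      connected set.\<close>
    obtain r where r: "r > 0" "ball (coord c p) r \<subseteq> coord c ` chart_dom c"
      using open_U p by (meson imageI openE)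
    have const: "scal (g c) (coord c p) = scal (g c) y" if "y \<in> ball (coord c p) r" for y
      by (rule has_derivative_zero_unique_connected[OF open_ball connected_ball
            der[OF subsetD[OF r(2)]] _ that])
        (simp_all add: r(1))
    let ?N = "chart_dom c \<inter> coord c -` ball (coord c p) r"
    have "open ?N"
      by (intro continuous_open_preimage chart_facts c open_ball)
    moreover have "p \<in> ?N" using p r by simp
    ultimately have "\<forall>\<^sub>F q in nhds p. q \<in> ?N" by (rule eventually_nhds_in_open)
    then show ?thesis
      unfolding eventually_at_filter
      by eventually_elim (use const in \<open>auto simp: scalar_curvature_chart[OF c] p\<close>)
  qed
  have "scalar_curvature A g p = scalar_curvature A g q" for p q
    by (rule connected_local_const[OF assms]) (auto simp: loc)
  then show "scalar_curvature A g constant_on UNIV" by (auto simp: constant_on_def)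
qed

end

theorem mainTheorem13:
  fixes A :: "('m::{t2_space, second_countable_topology}, 4) chart set"
    and g :: "('m, 4) metric"
  assumes "riemannian_manifold A g"
    and "compact (UNIV :: 'm set)"
    and "connected (UNIV :: 'm set)"
  shows "C_harmonic A g A g id \<longleftrightarrow> scalar_curvature A g constant_on UNIV"
proof -
  note M = assms(1)
  have "smooth_map A A id"
    using M by (simp add: smooth_map_def local_rep_def riemannian_manifold_def smooth_atlas_def)
  moreover have "C_operator (g c) (g d) (local_rep c d id) (coord c p) = 0 \<longleftrightarrow>
      (\<forall>i. pderiv_at i (scal (g c)) (coord c p) = 0)"
    if "c \<in> A" "d \<in> A" "p \<in> chart_dom c \<inter> chart_dom d" for c d p
    using that by (intro C_operator_isometry[OF local_isometry_transition[OF M]]) auto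
  \<comment> \<open>The criterion at p involves only the source chart c; the choice d = c shows that
    every point of c is tested.\<close>
  ultimately have "C_harmonic A g A g id \<longleftrightarrow>
      (\<forall>c\<in>A. \<forall>x\<in>coord c ` chart_dom c. \<forall>i. pderiv_at i (scal (g c)) x = 0)"
    unfolding C_harmonic_def by simp blast
  then show ?thesis
    by (simp only: scalar_curvature_constant_iff[OF M assms(3)])
qed

end
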